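(* Let $y_0\in Y$. Assume that $\mathrm{int}(\mathrm{cl}\,\mathcal{R}_{y_0})\neq\emptyset$, that $f$ and $g$ are Lipschitz continuous, and that the optimal solution $\gamma^*$ of the linear programming problem $\min_{\gamma\in W(y_0)}\int_G g(y,u)\,\gamma(dy,du)$ is unique. For each $N$ let $\psi^N\in D_N$ be a solution of the $N$-approximating problem, let $u^N(y)$, $y\in Y$, be defined by $$u^N(y)\in\mathrm{argmin}_{u\in A(y)}\{g(y,u)+\alpha\psi^N(f(y,u))\},$$ and let $y^N(\cdot)$ be the solution of $y^N(t+1)=f(y^N(t),u^N(y^N(t)))$, $t\in\{0,1,\dots\}$, with $y^N(0)=y_0$. Assume also that there exists an optimal admissible process $(\bar y(\cdot),\bar u(\cdot))$ starting at $y_0$ such that: (a) for any $t\in\{0,1,\dots\}$ there exists an open ball $Q_t$ centered at $\bar y(t)$ such that the minimizer $u^N(y)$ of $u\mapsto g(y,u)+\alpha\psi^N(f(y,u))$ over $A(y)$ is uniquely defined for $y\in Q_t\cap Y$; (b) $u^N(\cdot)$ is Lipschitz continuous on $Q_t\cap Y$ with Lipschitz constant independent of $N$ and $t$; (c) for all sufficiently large $N$, $y^N(t)\in Q_t$ for all $t\in\{0,1,\dots\}$. Then $$\lim_{N\to\infty}u^N(y^N(t))=\bar u(t)\ \text{ and }\ \lim_{N\to\infty}y^N(t)=\bar y(t)\quad\text{for all }t\in\{0,1,\dots\},\qquad \lim_{N\to\infty}V^N(y_0)=V(y_0),$$ where $V^N(y_0):=\sum_{t=0}^\infty\alpha^t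 g(y^N(t),u^N(y^N(t)))$.
   Context: Setting: $Y\subset\mathbb{R}^m$ is nonempty and compact, $U_0$ is a compact metric space, $U(\cdot)$ is an upper semicontinuous compact-valued set-valued map from $Y$ to $U_0$, $f:\mathbb{R}^m\times U_0\to\mathbb{R}^m$ and $g:\mathbb{R}^m\times U_0\to\mathbb{R}$ are continuous, and $\alpha\in(0,1)$. Put $A(y):=\{u\in U(y): f(y,u)\in Y\}$ for $y\in Y$ and $G:=\{(y,u): y\in Y,\ u\in A(y)\}$ (a compact set). Standing assumption: $A(y)\neq\emptyset$ for every $y\in Y$. An admissible process starting at $y_0\in Y$ is a pair of sequences $(y(t),u(t))_{t\ge0}$ with $y(0)=y_0$, $u(t)\in A(y(t))$ and $y(t+1)=f(y(t),u(t))$ for all $t\in\{0,1,\dots\}$. The optimal value is $V(y_0):=\inf\sum_{t=0}^\infty\alpha^t g(y(t),u(t))$ over all admissible processes starting at $y_0$; an admissible process is optimal if it attains this infimum. The reachable set $\mathcal{R}_{y_0}$ is the set of all points $y(t)$, over all admissible processes starting at $y_0$ and all $t\in\{0,1,\dots\}$; interior and closure are taken in $\mathbb{R}^m$. $\mathcal{P}(G)$ is the set of Borel probability measures on $G$, and $$W(y_0):=\Big\{\gamma\in\mathcal{P}(G):\int_G[\alpha(\varphi(f(y,u))-\varphi(y))+(1-\alpha)(\varphi(y_0)-\varphi(y))]\gamma(dy,du)=0\ \ \forall\varphi\in C(Y)\Big\}.$$ Let $\{\phi_i\}_{i=1}^\infty$ be a sequence of continuous real-valued functions on $Y$ with $\phi_1\equiv1$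 such that: (i) any finite collection of functions from the sequence is linearly independent on any nonempty open set (open subset of $\mathbb{R}^m$ contained in $Y$); (ii) for any $\psi\in C(Y)$ and $\delta>0$ there exist $N$ and real $\lambda_1,\dots,\lambda_N$ with $\max_{y\in Y}|\psi(y)-\sum_{i=1}^N\lambda_i\phi_i(y)|\le\delta$. Let $D_N:=\{\sum_{i=1}^N\lambda_i\phi_i:\lambda_i\in\mathbb{R}\}\subset C(Y)$. The $N$-approximating problem has optimal value $$\mu_N^*(y_0):=\sup_{\psi\in D_N}\min_{(y,u)\in G}\{g(y,u)+\alpha(\psi(f(y,u))-\psi(y))+(1-\alpha)(\psi(y_0)-\psi(y))\},$$ and a solution of it is a $\psi\in D_N$ attaining this supremum. *)

theory Defs
  imports "HOL-Probability.Probability"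
begin

text \<open>
  The control space is a compact subset of a metric space type \<open>'u\<close>; maps on
  \<open>Y\<close> are total functions whose values outside \<open>Y\<close> play no role.
\<close>

definition upper_semicontinuous_on ::
    "'a::topological_space set \<Rightarrow> ('a \<Rightarrow> 'b::topological_space set) \<Rightarrow> bool" where
  "upper_semicontinuous_on Y U \<longleftrightarrow>
     (\<forall>y\<in>Y. \<forall>V. open V \<and> U y \<subseteq> V \<longrightarrow> (\<forall>\<^sub>F y' in at y within Y. U y' \<subseteq> V))"

definition admissible_controls ::
    "('y \<times> 'u \<Rightarrow> 'y) \<Rightarrow> ('y \<Rightarrow> 'u set) \<Rightarrow> 'y set \<Rightarrow> 'y \<Rightarrow> 'u set" where
  "admissible_controls f U Y y = {u \<in> U y. f (y, u) \<in> Y}"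

definition admissible_graph ::
    "('y \<times> 'u \<Rightarrow> 'y) \<Rightarrow> ('y \<Rightarrow> 'u set) \<Rightarrow> 'y set \<Rightarrow> ('y \<times> 'u) set" where
  "admissible_graph f U Y = (SIGMA y:Y. admissible_controls f U Y y)"

definition admissible_process ::
    "('y \<times> 'u \<Rightarrow> 'y) \<Rightarrow> ('y \<Rightarrow> 'u set) \<Rightarrow> 'y set \<Rightarrow> 'y \<Rightarrow> (nat \<Rightarrow> 'y) \<Rightarrow> (nat \<Rightarrow> 'u) \<Rightarrow> bool" where
  "admissible_process f U Y y0 y u \<longleftrightarrow>
     y 0 = y0 \<and>
     (\<forall>t. u t \<in> admissible_controls f U Y (y t) \<and> y (Suc t) = f (y t, u t))"

definition discounted_cost ::
    "real \<Rightarrow> ('y \<times> 'u \<Rightarrow> real) \<Rightarrow> (nat \<Rightarrow> 'y) \<Rightarrow> (nat \<Rightarrow> 'u) \<Rightarrow> real" where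
  "discounted_cost \<alpha> g y u = (\<Sum>t. \<alpha> ^ t * g (y t, u t))"

definition optimal_value ::
    "real \<Rightarrow> ('y \<times> 'u \<Rightarrow> 'y) \<Rightarrow> ('y \<times> 'u \<Rightarrow> real) \<Rightarrow> ('y \<Rightarrow> 'u set) \<Rightarrow> 'y set \<Rightarrow> 'y \<Rightarrow> real" where
  "optimal_value \<alpha> f g U Y y0 =
     Inf {discounted_cost \<alpha> g y u | y u. admissible_process f U Y y0 y u}"

definition optimal_process ::
    "real \<Rightarrow> ('y \<times> 'u \<Rightarrow> 'y) \<Rightarrow> ('y \<times> 'u \<Rightarrow> real) \<Rightarrow> ('y \<Rightarrow> 'u set) \<Rightarrow> 'y set \<Rightarrow> 'y
     \<Rightarrow> (nat \<Rightarrow> 'y) \<Rightarrow> (nat \<Rightarrow> 'u) \<Rightarrow> bool" where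
  "optimal_process \<alpha> f g U Y y0 y u \<longleftrightarrow>
     admissible_process f U Y y0 y u \<and>
     discounted_cost \<alpha> g y u = optimal_value \<alpha> f g U Y y0"

definition reachable_set ::
    "('y \<times> 'u \<Rightarrow> 'y) \<Rightarrow> ('y \<Rightarrow> 'u set) \<Rightarrow> 'y set \<Rightarrow> 'y \<Rightarrow> 'y set" where
  "reachable_set f U Y y0 = {y t | y u t. admissible_process f U Y y0 y u}"

definition borel_prob_measures :: "'a::topological_space set \<Rightarrow> 'a measure set" where
  "borel_prob_measures G = {\<gamma>. sets \<gamma> = sets (restrict_space borel G) \<and> prob_space \<gamma>}"

definition W_set ::
    "real \<Rightarrow> ('y::topological_space \<times> 'u::topological_space \<Rightarrow> 'y) \<Rightarrow> ('y \<Rightarrow> 'u set) \<Rightarrow> 'y set \<Rightarrow> 'y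
     \<Rightarrow> ('y \<times> 'u) measure set" where
  "W_set \<alpha> f U Y y0 =
     {\<gamma> \<in> borel_prob_measures (admissible_graph f U Y).
        \<forall>\<phi> :: 'y \<Rightarrow> real. continuous_on Y \<phi> \<longrightarrow>
          (\<integral>(y, u). \<alpha> * (\<phi> (f (y, u)) - \<phi> y) + (1 - \<alpha>) * (\<phi> y0 - \<phi> y) \<partial>\<gamma>) = 0}"

text \<open>Linear independence of an indexed family, so that repetitions in it are excluded.\<close>

definition lin_indep_family_on :: "'a set \<Rightarrow> ('i \<Rightarrow> 'a \<Rightarrow> real) \<Rightarrow> 'i set \<Rightarrow> bool" where
  "lin_indep_family_on S \<phi> I \<longleftrightarrow>
     (\<forall>c. (\<forall>y\<in>S. (\<Sum>i\<in>I. c i * \<phi> i y) = 0) \<longrightarrow> (\<forall>i\<in>I. c i = 0))"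

text \<open>The functions are indexed from 1; \<open>\<phi> 0\<close> is never used.\<close>

definition approx_basis :: "'y::topological_space set \<Rightarrow> (nat \<Rightarrow> 'y \<Rightarrow> real) \<Rightarrow> bool" where
  "approx_basis Y \<phi> \<longleftrightarrow>
     (\<forall>i\<ge>1. continuous_on Y (\<phi> i)) \<and>
     (\<forall>y\<in>Y. \<phi> 1 y = 1) \<and>
     (\<forall>S I. open S \<and> S \<noteq> {} \<and> S \<subseteq> Y \<and> finite I \<and> I \<subseteq> {1..} \<longrightarrow> lin_indep_family_on S \<phi> I) \<and>
     (\<forall>\<psi> \<delta>. continuous_on Y \<psi> \<and> \<delta> > 0 \<longrightarrow>
        (\<exists>N c. \<forall>y\<in>Y. \<bar>\<psi> y - (\<Sum>i=1..N. c i * \<phi> i y)\<bar> \<le> \<delta>))"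

text \<open>Elements of \<open>C(Y)\<close> are compared on \<open>Y\<close> only.\<close>

definition D_space :: "'y set \<Rightarrow> (nat \<Rightarrow> 'y \<Rightarrow> real) \<Rightarrow> nat \<Rightarrow> ('y \<Rightarrow> real) set" where
  "D_space Y \<phi> N = {\<psi>. \<exists>c. \<forall>y\<in>Y. \<psi> y = (\<Sum>i=1..N. c i * \<phi> i y)}"

text \<open>
  The infimum is a minimum in the intended setting, where \<open>G\<close> is nonempty and compact and
  the functions involved are continuous.
\<close>

definition dual_objective ::
    "real \<Rightarrow> ('y \<times> 'u \<Rightarrow> 'y) \<Rightarrow> ('y \<times> 'u \<Rightarrow> real) \<Rightarrow> ('y \<Rightarrow> 'u set) \<Rightarrow> 'y set \<Rightarrow> 'y
     \<Rightarrow> ('y \<Rightarrow> real) \<Rightarrow> real" where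
  "dual_objective \<alpha> f g U Y y0 \<psi> =
     (INF (y, u) \<in> admissible_graph f U Y.
        g (y, u) + \<alpha> * (\<psi> (f (y, u)) - \<psi> y) + (1 - \<alpha>) * (\<psi> y0 - \<psi> y))"

definition approx_value ::
    "real \<Rightarrow> ('y \<times> 'u \<Rightarrow> 'y) \<Rightarrow> ('y \<times> 'u \<Rightarrow> real) \<Rightarrow> ('y \<Rightarrow> 'u set) \<Rightarrow> 'y set \<Rightarrow> 'y
     \<Rightarrow> (nat \<Rightarrow> 'y \<Rightarrow> real) \<Rightarrow> nat \<Rightarrow> real" where
  "approx_value \<alpha> f g U Y y0 \<phi> N =
     (SUP \<psi> \<in> D_space Y \<phi> N. dual_objective \<alpha> f g U Y y0 \<psi>)"

definition approx_solution ::
    "real \<Rightarrow> ('y \<times> 'u \<Rightarrow> 'y) \<Rightarrow> ('y \<times> 'u \<Rightarrow> real) \<Rightarrow> ('y \<Rightarrow> 'u set) \<Rightarrow> 'y set \<Rightarrow> 'y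
     \<Rightarrow> (nat \<Rightarrow> 'y \<Rightarrow> real) \<Rightarrow> nat \<Rightarrow> ('y \<Rightarrow> real) \<Rightarrow> bool" where
  "approx_solution \<alpha> f g U Y y0 \<phi> N \<psi> \<longleftrightarrow>
     \<psi> \<in> D_space Y \<phi> N \<and>
     dual_objective \<alpha> f g U Y y0 \<psi> = approx_value \<alpha> f g U Y y0 \<phi> N"

definition minimizing_control ::
    "real \<Rightarrow> ('y \<times> 'u \<Rightarrow> 'y) \<Rightarrow> ('y \<times> 'u \<Rightarrow> real) \<Rightarrow> ('y \<Rightarrow> 'u set) \<Rightarrow> 'y set
     \<Rightarrow> ('y \<Rightarrow> real) \<Rightarrow> 'y \<Rightarrow> 'u \<Rightarrow> bool" where
  "minimizing_control \<alpha> f g U Y \<psi> y =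
     is_arg_min (\<lambda>u. g (y, u) + \<alpha> * \<psi> (f (y, u))) (\<lambda>u. u \<in> admissible_controls f U Y y)"

end

theory Submission
  imports Defs
begin

text \<open>
  Everything rests on a strong duality that needs no functional analysis: allowing the
  trajectory to jump at \<open>k\<close> times the distance jumped gives a relaxed value function which is
  \<open>k\<close>-Lipschitz and dual feasible, and as \<open>k\<close> grows its value at \<open>y0\<close> tends to the optimal
  value, by compactness of the space of sequences in \<open>G\<close>. If, for infinitely many \<open>N\<close>, no
  minimizer of the Lagrangian of \<open>\<psi> N\<close> came near \<open>(ybar t, ubar t)\<close>, then a bump of the cost
  around that point would not change the approximating values, so duality for the perturbed
  cost would give an optimal process avoiding the point. Its occupational measure would be a
  second solution of the linear program. Hence minimizers come arbitrarily near
  \<open>(ybar t, ubar t)\<close>; their controls are values of \<open>uN N\<close>, and the uniform Lipschitz bound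
  carries this over first to \<open>ybar t\<close> and then, by induction on \<open>t\<close>, to the trajectories.
\<close>

section \<open>Discounted series, and limits of sequences in a compact set\<close>

lemma discounted_summable:
  fixes b :: "nat \<Rightarrow> real"
  assumes "0 < \<alpha>" "\<alpha> < 1" "\<And>t. \<bar>b t\<bar> \<le> B"
  shows "summable (\<lambda>t. \<alpha> ^ t * b t)"
proof (rule summable_comparison_test')
  show "summable (\<lambda>t. \<alpha> ^ t * B)"
    using assms by (intro summable_mult2 summable_geometric) auto
  show "norm (\<alpha> ^ t * b t) \<le> \<alpha> ^ t * B" if "t \<ge> 0" for t
    using assms by (simp add: abs_mult mult_left_mono)
qed

lemma discounted_split_head:
  fixes b :: "nat \<Rightarrow> real"
  assumes "0 < \<alpha>" "\<alpha> < 1" "\<And>t. \<bar>b t\<bar> \<le> B"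
  shows "(\<Sum>t. \<alpha> ^ t * b t) = b 0 + \<alpha> * (\<Sum>t. \<alpha> ^ t * b (Suc t))"
proof -
  have "summable (\<lambda>t. \<alpha> ^ t * b t)" "summable (\<lambda>t. \<alpha> ^ t * b (Suc t))"
    using discounted_summable[OF assms(1,2), of b B] discounted_summable[OF assms(1,2), of "\<lambda>t. b (Suc t)" B]
      assms(3) by auto
  then show ?thesis
    using suminf_split_head[of "\<lambda>t. \<alpha> ^ t * b t"] by (simp add: suminf_mult mult.assoc)
qed

text \<open>Tannery's theorem, dominated by \<open>\<alpha> ^ t * B\<close>. The bound is required
  only for large \<open>n\<close> because the feedback processes are known to be admissible only
  from \<open>N = 1\<close> on.\<close>

lemma discounted_tendsto:
  fixes b :: "nat \<Rightarrow> nat \<Rightarrow> real"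
  assumes \<alpha>: "0 < \<alpha>" "\<alpha> < 1"
    and bound: "\<forall>\<^sub>F n in sequentially. \<forall>t. \<bar>b n t\<bar> \<le> B"
    and lim: "\<And>t. (\<lambda>n. b n t) \<longlonglongrightarrow> b' t"
  shows "(\<lambda>n. \<Sum>t. \<alpha> ^ t * b n t) \<longlonglongrightarrow> (\<Sum>t. \<alpha> ^ t * b' t)"
proof -
  have "summable (\<lambda>t. \<alpha> ^ t * B)"
    using \<alpha> by (intro summable_mult2 summable_geometric) auto
  moreover have "eventually (\<lambda>(t, n). norm (\<alpha> ^ t * b n t) \<le> \<alpha> ^ t * B) (at_top \<times>\<^sub>F sequentially)"
    unfolding eventually_prod_filter case_prod_conv
    using \<alpha> bound
    by (intro exI[of _ "\<lambda>_. True"] exI[of _ "\<lambda>n. \<forall>t. \<bar>b n t\<bar> \<le> B"])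
       (auto simp: abs_mult mult_left_mono)
  moreover have "(\<lambda>n. \<alpha> ^ t * b n t) \<longlonglongrightarrow> \<alpha> ^ t * b' t" for t
    by (intro tendsto_intros lim)
  ultimately show ?thesis
    using tannerys_theorem[of "\<lambda>t n. \<alpha> ^ t * b n t" "\<lambda>t. \<alpha> ^ t * b' t" sequentially "\<lambda>t. \<alpha> ^ t * B"]
    by auto
qed

text \<open>Each term is a difference of consecutive members of the null sequence
  \<open>\<alpha> ^ t * p t\<close>. With \<open>p t\<close> the value of a test function at time
  \<open>t\<close>, this makes its contribution to the Lagrangian collapse along a process.\<close>

lemma discounted_telescope:
  fixes p :: "nat \<Rightarrow> real"
  assumes "0 < \<alpha>" "\<alpha> < 1" "\<And>t. \<bar>p t\<bar> \<le> B"
  shows "(\<lambda>t. \<alpha> ^ t * (\<alpha> * p (Suc t) - p t)) sums (- p 0)"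
proof -
  have "(\<lambda>t. \<alpha> ^ t * p t) \<longlonglongrightarrow> 0"
    by (rule summable_LIMSEQ_zero[OF discounted_summable[OF assms]])
  from telescope_sums[OF this] show ?thesis
    by (simp add: algebra_simps)
qed

text \<open>Tychonoff makes the product compact, and a countable product of metric spaces is first
  countable, so compactness yields convergent subsequences without a diagonal argument.\<close>

lemma compact_pointwise_subsequence:
  fixes G :: "'a::metric_space set"
  assumes "compact G" and z: "\<And>(n::nat) (t::nat). z n t \<in> G"
  shows "\<exists>s z'. strict_mono (s :: nat \<Rightarrow> nat) \<and> (\<forall>t. z' t \<in> G \<and> (\<lambda>n. z (s n) t) \<longlonglongrightarrow> z' t)"
proof -
  have "compact (PiE (UNIV :: nat set) (\<lambda>_. G))"
    using compactin_PiE[of "\<lambda>_::nat. euclidean" UNIV "\<lambda>_. G"] assms(1)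
    by (simp add: euclidean_product_topology)
  then have "seq_compact (PiE (UNIV :: nat set) (\<lambda>_. G))"
    by (rule compact_imp_seq_compact)
  moreover have "\<forall>n. z n \<in> PiE (UNIV :: nat set) (\<lambda>_. G)"
    using z by auto
  ultimately obtain z' s where z': "z' \<in> PiE (UNIV :: nat set) (\<lambda>_. G)" and s: "strict_mono s"
    and lim: "(z \<circ> s) \<longlonglongrightarrow> z'"
    unfolding seq_compact_def by metis
  have "(\<lambda>n. z (s n) t) \<longlonglongrightarrow> z' t" for t
    using continuous_on_tendsto_compose[OF continuous_on_product_coordinates[of t] lim]
    by (simp add: o_def)
  with z' s show ?thesis
    by blast
qed

section \<open>The control system and its admissible graph\<close>

text \<open>The running cost is not fixed here but passed to the lemmas as \<open>c\<close>, because
  duality is applied both to the given cost and to a perturbation of it.\<close>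

locale compact_control_system =
  fixes \<alpha> :: real
    and f :: "'y::metric_space \<times> 'u::metric_space \<Rightarrow> 'y"
    and U :: "'y \<Rightarrow> 'u set"
    and Y :: "'y set"
    and y0 :: 'y
  assumes \<alpha>: "0 < \<alpha>" "\<alpha> < 1"
    and compact_Y: "compact Y"
    and compact_G: "compact (admissible_graph f U Y)"
    and cont_f: "continuous_on (admissible_graph f U Y) f"
    and nonempty: "\<And>y. y \<in> Y \<Longrightarrow> admissible_controls f U Y y \<noteq> {}"
    and y0: "y0 \<in> Y"
begin

abbreviation "G \<equiv> admissible_graph f U Y"

lemma f_in_Y: "z \<in> G \<Longrightarrow> f z \<in> Y"
  and fst_in_Y: "z \<in> G \<Longrightarrow> fst z \<in> Y"
  by (auto simp: admissible_graph_def admissible_controls_def)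

lemma process_in_G:
  assumes "admissible_process f U Y y0 y u"
  shows "(y t, u t) \<in> G"
proof -
  have "y t \<in> Y"
    using assms y0
    by (induction t) (auto simp: admissible_process_def admissible_controls_def)
  with assms show ?thesis
    by (auto simp: admissible_process_def admissible_graph_def)
qed

lemma process_of_G:
  assumes "\<And>t. z t \<in> G" "fst (z 0) = y0" "\<And>t. fst (z (Suc t)) = f (z t)"
  shows "admissible_process f U Y y0 (fst \<circ> z) (snd \<circ> z)"
  unfolding admissible_process_def
proof (intro conjI allI)
  show "(fst \<circ> z) 0 = y0"
    using assms(2) by simp
  show "(snd \<circ> z) t \<in> admissible_controls f U Y ((fst \<circ> z) t)" for t
    using assms(1)[of t] by (cases "z t") (auto simp: admissible_graph_def)
  show "(fst \<circ> z) (Suc t) = f ((fst \<circ> z) t, (snd \<circ> z) t)" for t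
    using assms(3)[of t] by simp
qed

lemma bounded_on_G:
  fixes c :: "'y \<times> 'u \<Rightarrow> real"
  assumes "continuous_on G c"
  obtains B where "0 \<le> B" "\<And>z. z \<in> G \<Longrightarrow> \<bar>c z\<bar> \<le> B"
proof -
  have "bounded (c ` G)"
    by (intro compact_imp_bounded compact_continuous_image assms compact_G)
  then obtain B where "0 < B" "\<And>z. z \<in> G \<Longrightarrow> \<bar>c z\<bar> \<le> B"
    unfolding bounded_pos by auto
  then show ?thesis
    by (intro that[of B]) auto
qed

section \<open>The relaxed problem with penalized jumps\<close>

text \<open>The dynamics are replaced by a price: the state may jump from \<open>y\<close> to
  \<open>fst (z 0)\<close>, and from \<open>f (z t)\<close> to \<open>fst (z (Suc t))\<close>. The
  second jump takes place at time \<open>t + 1\<close>, hence the extra factor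
  \<open>\<alpha>\<close>.\<close>

definition penalized_cost :: "('y \<times> 'u \<Rightarrow> real) \<Rightarrow> real \<Rightarrow> 'y \<Rightarrow> (nat \<Rightarrow> 'y \<times> 'u) \<Rightarrow> real" where
  "penalized_cost c k y z = k * dist y (fst (z 0)) +
     (\<Sum>t. \<alpha> ^ t * (c (z t) + \<alpha> * k * dist (fst (z (Suc t))) (f (z t))))"

text \<open>The set of competing sequences does not depend on \<open>y\<close>; this is what makes
  the value Lipschitz in \<open>y\<close>, whereas the true value function need not even be
  continuous.\<close>

definition penalized_value :: "('y \<times> 'u \<Rightarrow> real) \<Rightarrow> real \<Rightarrow> 'y \<Rightarrow> real" where
  "penalized_value c k y = (INF z\<in>{z. range z \<subseteq> G}. penalized_cost c k y z)"

lemma sequence_in_G_exists: "\<exists>z. range z \<subseteq> G"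
proof -
  obtain u where "(y0, u) \<in> G"
    using nonempty[OF y0] y0 by (auto simp: admissible_graph_def)
  then show ?thesis
    by (intro exI[of _ "\<lambda>_. (y0, u)"]) auto
qed

lemma jump_bounded:
  "\<exists>R. \<forall>z\<in>G. \<forall>z'\<in>G. dist (fst z') (f z) \<le> R"
proof -
  have "bounded Y"
    by (rule compact_imp_bounded[OF compact_Y])
  then have "dist (fst z') (f z) \<le> diameter Y" if "z \<in> G" "z' \<in> G" for z z'
    using that f_in_Y fst_in_Y by (intro diameter_bounded_bound) auto
  then show ?thesis
    by blast
qed

lemma penalized_bounded:
  assumes "continuous_on G c" "0 \<le> k"
  shows "\<exists>B. \<forall>z t. range z \<subseteq> G \<longrightarrow>
    \<bar>c (z t) + \<alpha> * k * dist (fst (z (Suc t))) (f (z t))\<bar> \<le> B"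
proof -
  obtain B where B: "\<And>z. z \<in> G \<Longrightarrow> \<bar>c z\<bar> \<le> B"
    using bounded_on_G[OF assms(1)] by blast
  obtain R where R: "\<And>z z'. z \<in> G \<Longrightarrow> z' \<in> G \<Longrightarrow> dist (fst z') (f z) \<le> R"
    using jump_bounded by blast
  have "\<bar>c (z t) + \<alpha> * k * dist (fst (z (Suc t))) (f (z t))\<bar> \<le> B + \<alpha> * k * R"
    if "range z \<subseteq> G" for z :: "nat \<Rightarrow> 'y \<times> 'u" and t
  proof -
    have "\<bar>c (z t) + \<alpha> * k * dist (fst (z (Suc t))) (f (z t))\<bar>
        \<le> \<bar>c (z t)\<bar> + \<alpha> * k * dist (fst (z (Suc t))) (f (z t))"
      using \<alpha> assms(2) by (intro order_trans[OF abs_triangle_ineq]) (simp add: abs_mult)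
    also have "\<dots> \<le> B + \<alpha> * k * R"
      using that \<alpha> assms(2) by (intro add_mono B mult_left_mono R) auto
    finally show ?thesis .
  qed
  then show ?thesis by blast
qed

lemma penalized_summable:
  assumes "continuous_on G c" "0 \<le> k" "range z \<subseteq> G"
  shows "summable (\<lambda>t. \<alpha> ^ t * (c (z t) + \<alpha> * k * dist (fst (z (Suc t))) (f (z t))))"
proof -
  obtain B where "\<And>z t. range z \<subseteq> G \<Longrightarrow>
      \<bar>c (z t) + \<alpha> * k * dist (fst (z (Suc t))) (f (z t))\<bar> \<le> B"
    using penalized_bounded[OF assms(1,2)] by blast
  then show ?thesis
    using assms(3) by (intro discounted_summable[OF \<alpha>])
qed

lemma cost_summable:
  assumes "continuous_on G c" "range z \<subseteq> G"
  shows "summable (\<lambda>t. \<alpha> ^ t * c (z t))"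
  using penalized_summable[OF assms(1) order.refl assms(2)] by simp

lemma penalized_cost_ge_cost:
  assumes "continuous_on G c" "0 \<le> k" "range z \<subseteq> G"
  shows "k * dist y (fst (z 0)) + (\<Sum>t. \<alpha> ^ t * c (z t)) \<le> penalized_cost c k y z"
  unfolding penalized_cost_def
  using \<alpha> assms(2)
  by (intro add_left_mono suminf_le penalized_summable cost_summable assms mult_left_mono) auto

lemma penalized_cost_ge_jump:
  assumes "continuous_on G c" "0 \<le> k" "range z \<subseteq> G"
  shows "\<alpha> ^ t * (\<alpha> * k * dist (fst (z (Suc t))) (f (z t))) + (\<Sum>t. \<alpha> ^ t * c (z t))
    \<le> penalized_cost c k y z"
proof -
  let ?d = "\<lambda>t. \<alpha> ^ t * (\<alpha> * k * dist (fst (z (Suc t))) (f (z t)))"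
  have sum: "summable ?d"
    using summable_diff[OF penalized_summable[OF assms] cost_summable[OF assms(1,3)]]
    by (simp add: algebra_simps)
  have "?d t \<le> suminf ?d"
    using sum_le_suminf[OF sum, of "{t}"] \<alpha> assms(2) by simp
  moreover have "suminf ?d + (\<Sum>t. \<alpha> ^ t * c (z t)) =
      (\<Sum>t. \<alpha> ^ t * (c (z t) + \<alpha> * k * dist (fst (z (Suc t))) (f (z t))))"
    using suminf_add[OF sum cost_summable[OF assms(1,3)]] by (simp add: algebra_simps)
  moreover have "0 \<le> k * dist y (fst (z 0))"
    using assms(2) by simp
  ultimately show ?thesis
    unfolding penalized_cost_def by linarith
qed

lemma cost_lower_bound:
  assumes "continuous_on G c"
  shows "\<exists>B. \<forall>z. range z \<subseteq> G \<longrightarrow> B \<le> (\<Sum>t. \<alpha> ^ t * c (z t))"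
proof -
  obtain B where B: "\<And>z. z \<in> G \<Longrightarrow> \<bar>c z\<bar> \<le> B"
    using bounded_on_G[OF assms] by blast
  have "(\<Sum>t. \<alpha> ^ t * (- B)) \<le> (\<Sum>t. \<alpha> ^ t * c (z t))" if "range z \<subseteq> G" for z
  proof (rule suminf_le)
    show "summable (\<lambda>t. \<alpha> ^ t * c (z t))"
      by (rule cost_summable[OF assms that])
    show "\<alpha> ^ t * (- B) \<le> \<alpha> ^ t * c (z t)" for t
      using B[of "z t"] range_subsetD[OF that, of t] \<alpha> by (intro mult_left_mono) auto
    show "summable (\<lambda>t. \<alpha> ^ t * (- B))"
      using \<alpha> by (intro summable_mult2 summable_geometric) auto
  qed
  then show ?thesis by blast
qed

lemma penalized_bdd_below:
  assumes "continuous_on G c" "0 \<le> k"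
  shows "bdd_below (penalized_cost c k y ` {z. range z \<subseteq> G})"
proof -
  obtain B where "\<And>z. range z \<subseteq> G \<Longrightarrow> B \<le> (\<Sum>t. \<alpha> ^ t * c (z t))"
    using cost_lower_bound[OF assms(1)] by blast
  then have "0 + B \<le> k * dist y (fst (z 0)) + (\<Sum>t. \<alpha> ^ t * c (z t))" if "range z \<subseteq> G" for z
    using that assms(2) by (intro add_mono) auto
  then have "B \<le> penalized_cost c k y z" if "range z \<subseteq> G" for z
    using order_trans[OF _ penalized_cost_ge_cost[OF assms that]] that by simp
  then show ?thesis
    by (intro bdd_belowI[of _ B]) auto
qed

text \<open>The starting point enters the cost of a sequence only through the first jump, where the
  triangle inequality applies.\<close>

lemma penalized_value_lipschitz:
  assumes "continuous_on G c" "0 \<le> k"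
  shows "k-lipschitz_on S (penalized_value c k)"
proof (rule lipschitz_onI)
  have *: "penalized_value c k y \<le> k * dist y y' + penalized_value c k y'" for y y'
  proof -
    have "penalized_value c k y - k * dist y y' \<le> penalized_value c k y'"
      unfolding penalized_value_def[of c k y']
    proof (rule cINF_greatest)
      show "{z :: nat \<Rightarrow> 'y \<times> 'u. range z \<subseteq> G} \<noteq> {}"
        using sequence_in_G_exists by auto
      fix z :: "nat \<Rightarrow> 'y \<times> 'u"
      assume "z \<in> {z. range z \<subseteq> G}"
      then have "penalized_value c k y \<le> penalized_cost c k y z"
        unfolding penalized_value_def by (intro cINF_lower penalized_bdd_below assms)
      also have "\<dots> \<le> k * dist y y' + penalized_cost c k y' z"
        using mult_left_mono[OF dist_triangle[of y "fst (z 0)" y'] assms(2)]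
        unfolding penalized_cost_def by (simp add: algebra_simps)
      finally show "penalized_value c k y - k * dist y y' \<le> penalized_cost c k y' z"
        by simp
    qed
    then show ?thesis by simp
  qed
  show "dist (penalized_value c k x) (penalized_value c k y) \<le> k * dist x y" for x y
    using *[of x y] *[of y x] by (simp add: dist_real_def dist_commute)
qed (fact assms)

text \<open>One half of the dynamic programming principle: any sequence started at
  \<open>f w\<close> can be preceded by \<open>w\<close>, and its initial jump then becomes the
  discounted jump into time 1.\<close>

lemma penalized_value_step:
  assumes "continuous_on G c" "0 \<le> k" "w \<in> G"
  shows "penalized_value c k (fst w) \<le> c w + \<alpha> * penalized_value c k (f w)"
proof -
  \<comment> \<open>Solved for the infimum on the right, so that it suffices to bound each single
    sequence from below.\<close>
  have "(penalized_value c k (fst w) - c w) / \<alpha> \<le> penalized_value c k (f w)"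
    unfolding penalized_value_def[of c k "f w"]
  proof (rule cINF_greatest)
    show "{z :: nat \<Rightarrow> 'y \<times> 'u. range z \<subseteq> G} \<noteq> {}"
      using sequence_in_G_exists by auto
    fix z :: "nat \<Rightarrow> 'y \<times> 'u"
    assume "z \<in> {z. range z \<subseteq> G}"
    then have z: "range z \<subseteq> G" by simp
    \<comment> \<open>Started at \<open>fst w\<close>, the extended sequence has no initial jump to
      pay for.\<close>
    define z' where "z' = case_nat w z"
    have z': "range z' \<subseteq> G"
      using z assms(3) by (force simp: z'_def split: nat.splits)
    obtain B where B: "\<And>z t. range z \<subseteq> G \<Longrightarrow>
        \<bar>c (z t) + \<alpha> * k * dist (fst (z (Suc t))) (f (z t))\<bar> \<le> B"
      using penalized_bounded[OF assms(1,2)] by blast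
    have sum: "summable (\<lambda>t. \<alpha> ^ t * (c (z t) + \<alpha> * k * dist (fst (z (Suc t))) (f (z t))))"
      by (rule penalized_summable[OF assms(1,2) z])
    have "penalized_value c k (fst w) \<le> penalized_cost c k (fst w) z'"
      unfolding penalized_value_def using z' by (intro cINF_lower penalized_bdd_below assms) auto
    also have "\<dots> = c w + \<alpha> * k * dist (fst (z 0)) (f w) +
        \<alpha> * (\<Sum>t. \<alpha> ^ t * (c (z t) + \<alpha> * k * dist (fst (z (Suc t))) (f (z t))))"
      unfolding penalized_cost_def by (subst discounted_split_head[OF \<alpha> B[OF z']]) (simp add: z'_def)
    also have "\<dots> = c w + \<alpha> * penalized_cost c k (f w) z"
      unfolding penalized_cost_def by (simp add: algebra_simps dist_commute)
    finally show "(penalized_value c k (fst w) - c w) / \<alpha> \<le> penalized_cost c k (f w) z"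
      using \<alpha> by (simp add: field_simps)
  qed
  then show ?thesis
    using \<alpha> by (simp add: field_simps)
qed

section \<open>The Lagrangian and strong duality\<close>

text \<open>The dual objective is its infimum over \<open>G\<close>. It is affine in
  \<open>\<psi>\<close>, and for zero cost it is the integrand in the constraints that define
  \<open>W_set\<close>.\<close>

definition lagrangian :: "('y \<times> 'u \<Rightarrow> real) \<Rightarrow> ('y \<Rightarrow> real) \<Rightarrow> 'y \<times> 'u \<Rightarrow> real" where
  "lagrangian c \<psi> z = c z + \<alpha> * (\<psi> (f z) - \<psi> (fst z)) + (1 - \<alpha>) * (\<psi> y0 - \<psi> (fst z))"

lemma dual_objective_eq: "dual_objective \<alpha> f c U Y y0 \<psi> = (INF z\<in>G. lagrangian c \<psi> z)"
  unfolding dual_objective_def lagrangian_def by (simp add: case_prod_unfold)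

lemma continuous_lagrangian:
  assumes "continuous_on G c" "continuous_on Y \<psi>"
  shows "continuous_on G (lagrangian c \<psi>)"
  unfolding lagrangian_def
  by (intro continuous_intros assms continuous_on_compose2[OF assms(2)] cont_f)
     (auto dest: f_in_Y fst_in_Y)

lemma G_nonempty: "G \<noteq> {}"
  using sequence_in_G_exists by auto

lemma dual_objective_le:
  assumes "continuous_on G c" "continuous_on Y \<psi>" "z \<in> G"
  shows "dual_objective \<alpha> f c U Y y0 \<psi> \<le> lagrangian c \<psi> z"
proof -
  have "bdd_below (lagrangian c \<psi> ` G)"
    by (intro bounded_imp_bdd_below compact_imp_bounded compact_continuous_image
        continuous_lagrangian assms compact_G)
  then show ?thesis
    unfolding dual_objective_eq by (rule cINF_lower[OF _ assms(3)])
qed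

lemma dual_objective_ge:
  assumes "\<And>z. z \<in> G \<Longrightarrow> d \<le> lagrangian c \<psi> z"
  shows "d \<le> dual_objective \<alpha> f c U Y y0 \<psi>"
  unfolding dual_objective_eq by (intro cINF_greatest G_nonempty assms)

text \<open>The Lagrangian regroups as \<open>c z + \<alpha> * \<psi> (f z) - \<psi> (fst z)\<close>
  plus \<open>(1 - \<alpha>) * \<psi> y0\<close>, and \<open>penalized_value_step\<close> makes the
  first group nonnegative.\<close>

lemma penalized_value_dual:
  assumes "continuous_on G c" "0 \<le> k"
  shows "(1 - \<alpha>) * penalized_value c k y0 \<le> dual_objective \<alpha> f c U Y y0 (penalized_value c k)"
proof (rule dual_objective_ge)
  fix z
  assume "z \<in> G"
  from penalized_value_step[OF assms this]
  show "(1 - \<alpha>) * penalized_value c k y0 \<le> lagrangian c (penalized_value c k) z"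
    by (simp add: lagrangian_def algebra_simps)
qed

text \<open>
  As the penalty grows, near-minimizers of the penalized cost accumulate at a genuine process.
\<close>

lemma process_of_dual_bound:
  assumes c: "continuous_on G c"
    and dual: "\<And>\<psi>. continuous_on Y \<psi> \<Longrightarrow> dual_objective \<alpha> f c U Y y0 \<psi> \<le> (1 - \<alpha>) * m"
  obtains y u where "admissible_process f U Y y0 y u" "discounted_cost \<alpha> c y u \<le> m"
proof -
  \<comment> \<open>The dual bound, tested with the relaxed value itself, keeps that value at
    \<open>y0\<close> below \<open>m\<close> for every weight \<open>n\<close>; the slack is there
    because a minimizing sequence is only approximated.\<close>
  have "\<exists>z. range z \<subseteq> G \<and> penalized_cost c (real n) y0 z < m + 1 / Suc n" for n
  proof -
    have "continuous_on Y (penalized_value c (real n))"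
      using penalized_value_lipschitz[OF c] by (rule lipschitz_on_continuous_on) simp
    from penalized_value_dual[OF c, of n] dual[OF this]
    have "(1 - \<alpha>) * penalized_value c n y0 \<le> (1 - \<alpha>) * m"
      by simp
    then have "penalized_value c n y0 \<le> m"
      using \<alpha> by simp
    also have "m < m + 1 / Suc n"
      by simp
    finally have "penalized_value c n y0 < m + 1 / Suc n" .
    then show ?thesis
      unfolding penalized_value_def
      using cINF_less_iff[OF _ penalized_bdd_below[OF c, of n y0]] sequence_in_G_exists by auto
  qed
  then obtain z where z: "\<And>n. range (z n) \<subseteq> G"
    and cost: "\<And>n. penalized_cost c (real n) y0 (z n) < m + 1 / Suc n"
    by metis
  have zG: "z n t \<in> G" for n t
    using range_subsetD[OF z] .
  obtain s z' where s: "strict_mono s" and z': "\<And>t. z' t \<in> G"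
    and lim: "\<And>t. (\<lambda>n. z (s n) t) \<longlonglongrightarrow> z' t"
    using compact_pointwise_subsequence[OF compact_G, of z] zG by blast
  obtain C where C: "\<And>z. range z \<subseteq> G \<Longrightarrow> C \<le> (\<Sum>t. \<alpha> ^ t * c (z t))"
    using cost_lower_bound[OF c] by blast
  have zC: "C \<le> (\<Sum>t. \<alpha> ^ t * c (z n t))" for n
    by (rule C[OF z])
  have inv: "(\<lambda>n. K / real (s n)) \<longlonglongrightarrow> 0" for K
    using LIMSEQ_subseq_LIMSEQ[OF lim_const_over_n[of K] s] by (simp add: o_def)
  have pos: "\<forall>\<^sub>F n in sequentially. 0 < s n"
    by (rule eventually_compose_filterlim[OF eventually_gt_at_top filterlim_subseq[OF s]])
  have cost': "penalized_cost c (real n) y0 (z n) \<le> m + 1" for n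
  proof -
    have "1 / real (Suc n) \<le> 1"
      by simp
    with cost[of n] show ?thesis
      by linarith
  qed
  \<comment> \<open>The costs without penalty are at least \<open>C\<close> and the totals at most
    \<open>m + 1\<close>, so the penalties stay below \<open>m + 1 - C\<close>. A jump weighted by
    \<open>n\<close> is therefore of order \<open>1 / n\<close> and disappears in the limit; the
    same argument gives the dynamics below.\<close>
  have zero: "fst (z' 0) = y0"
  proof -
    have "dist y0 (fst (z n 0)) \<le> (m + 1 - C) / n" if "n > 0" for n
    proof -
      have "n * dist y0 (fst (z n 0)) \<le> m + 1 - C"
        using penalized_cost_ge_cost[OF c of_nat_0_le_iff z, of n y0 n] zC[of n] cost'[of n]
        by linarith
      with that show ?thesis
        by (simp add: pos_le_divide_eq mult.commute)
    qed
    then have "\<forall>\<^sub>F n in sequentially. dist y0 (fst (z (s n) 0)) \<le> (m + 1 - C) / s n"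
      using pos by (rule eventually_mono[rotated])
    then have "dist y0 (fst (z' 0)) \<le> 0"
      by (rule tendsto_le[OF trivial_limit_sequentially inv
            tendsto_dist[OF tendsto_const tendsto_fst[OF lim]]])
    then show ?thesis by simp
  qed
  have step: "fst (z' (Suc t)) = f (z' t)" for t
  proof -
    have flim: "(\<lambda>n. f (z (s n) t)) \<longlonglongrightarrow> f (z' t)"
      by (rule continuous_on_tendsto_compose[OF cont_f lim]) (auto simp: zG z')
    have "dist (fst (z n (Suc t))) (f (z n t)) \<le> ((m + 1 - C) / \<alpha> ^ Suc t) / n" if "n > 0" for n
    proof -
      have "\<alpha> ^ t * (\<alpha> * n * dist (fst (z n (Suc t))) (f (z n t))) \<le> m + 1 - C"
        using penalized_cost_ge_jump[OF c of_nat_0_le_iff z, of t n n y0] zC[of n] cost'[of n]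
        by linarith
      then have "dist (fst (z n (Suc t))) (f (z n t)) * (\<alpha> ^ Suc t * n) \<le> m + 1 - C"
        by (simp add: mult_ac)
      moreover have "0 < \<alpha> ^ Suc t * n"
        using that \<alpha> by simp
      ultimately show ?thesis
        unfolding divide_divide_eq_left by (simp only: pos_le_divide_eq)
    qed
    then have "\<forall>\<^sub>F n in sequentially. dist (fst (z (s n) (Suc t))) (f (z (s n) t))
        \<le> ((m + 1 - C) / \<alpha> ^ Suc t) / s n"
      using pos by (rule eventually_mono[rotated])
    then have "dist (fst (z' (Suc t))) (f (z' t)) \<le> 0"
      by (rule tendsto_le[OF trivial_limit_sequentially inv tendsto_dist[OF tendsto_fst[OF lim] flim]])
    then show ?thesis by simp
  qed
  have "(\<Sum>t. \<alpha> ^ t * c (z' t)) \<le> m"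
  proof (rule tendsto_le[OF trivial_limit_sequentially])
    obtain B where B: "\<And>z. z \<in> G \<Longrightarrow> \<bar>c z\<bar> \<le> B"
      using bounded_on_G[OF c] by blast
    show "(\<lambda>n. \<Sum>t. \<alpha> ^ t * c (z (s n) t)) \<longlonglongrightarrow> (\<Sum>t. \<alpha> ^ t * c (z' t))"
    proof (rule discounted_tendsto[OF \<alpha>])
      show "\<forall>\<^sub>F n in sequentially. \<forall>t. \<bar>c (z (s n) t)\<bar> \<le> B"
        by (intro always_eventually allI B zG)
      show "(\<lambda>n. c (z (s n) t)) \<longlonglongrightarrow> c (z' t)" for t
        by (rule continuous_on_tendsto_compose[OF c lim]) (auto simp: zG z')
    qed
    show "(\<lambda>n. m + 1 / Suc (s n)) \<longlonglongrightarrow> m"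
      using tendsto_add[OF tendsto_const LIMSEQ_subseq_LIMSEQ[OF LIMSEQ_Suc[OF lim_const_over_n[of 1]] s], of m]
      by (simp add: o_def)
    have "(\<Sum>t. \<alpha> ^ t * c (z n t)) \<le> m + 1 / Suc n" for n
      using penalized_cost_ge_cost[OF c of_nat_0_le_iff z, of n y0 n] cost[of n]
        mult_nonneg_nonneg[OF of_nat_0_le_iff zero_le_dist, of n y0 "fst (z n 0)"] by linarith
    then show "\<forall>\<^sub>F n in sequentially. (\<Sum>t. \<alpha> ^ t * c (z (s n) t)) \<le> m + 1 / Suc (s n)"
      by simp
  qed
  then show ?thesis
    using that[OF process_of_G[OF z' zero step]] by (simp add: discounted_cost_def)
qed

text \<open>Along a process \<open>f (y t, u t)\<close> is \<open>y (Suc t)\<close>, so the terms in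
  \<open>\<psi>\<close> telescope to \<open>- \<psi> y0\<close>, which the constant term
  \<open>(1 - \<alpha>) * \<psi> y0\<close> compensates after summation.\<close>

lemma lagrangian_sums:
  assumes c: "continuous_on G c" and \<psi>: "continuous_on Y \<psi>"
    and p: "admissible_process f U Y y0 y u"
  shows "(\<lambda>t. \<alpha> ^ t * lagrangian c \<psi> (y t, u t)) sums discounted_cost \<alpha> c y u"
proof -
  have "bounded (\<psi> ` Y)"
    by (intro compact_imp_bounded compact_continuous_image \<psi> compact_Y)
  then obtain B where "\<And>y. y \<in> Y \<Longrightarrow> \<bar>\<psi> y\<bar> \<le> B"
    unfolding bounded_iff by auto
  then have "\<bar>\<psi> (y t)\<bar> \<le> B" for t
    using process_in_G[OF p, of t] fst_in_Y by force
  from discounted_telescope[OF \<alpha>, of "\<lambda>t. \<psi> (y t)", OF this]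
  have 1: "(\<lambda>t. \<alpha> ^ t * (\<alpha> * \<psi> (y (Suc t)) - \<psi> (y t))) sums (- \<psi> y0)"
    using p by (simp add: admissible_process_def)
  have 2: "(\<lambda>t. \<alpha> ^ t * c (y t, u t)) sums discounted_cost \<alpha> c y u"
    unfolding discounted_cost_def using process_in_G[OF p]
    by (intro summable_sums cost_summable[OF c, of "\<lambda>t. (y t, u t)"]) auto
  have 3: "(\<lambda>t. \<alpha> ^ t * ((1 - \<alpha>) * \<psi> y0)) sums (1 / (1 - \<alpha>) * ((1 - \<alpha>) * \<psi> y0))"
    using \<alpha> by (intro sums_mult2 geometric_sums) auto
  have "(\<lambda>t. \<alpha> ^ t * lagrangian c \<psi> (y t, u t)) =
    (\<lambda>t. \<alpha> ^ t * c (y t, u t) + (\<alpha> ^ t * (\<alpha> * \<psi> (y (Suc t)) - \<psi> (y t)) + \<alpha> ^ t * ((1 - \<alpha>) * \<psi> y0)))"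
    using p by (intro ext) (simp add: lagrangian_def admissible_process_def algebra_simps)
  with sums_add[OF 2 sums_add[OF 1 3]] \<alpha> show ?thesis
    by simp
qed

text \<open>Weak duality: with weights \<open>(1 - \<alpha>) * \<alpha> ^ t\<close> the right-hand
  side is an average of the Lagrangian along the process, hence at least its infimum over
  \<open>G\<close>.\<close>

lemma dual_objective_le_cost:
  assumes c: "continuous_on G c" and \<psi>: "continuous_on Y \<psi>"
    and p: "admissible_process f U Y y0 y u"
  shows "dual_objective \<alpha> f c U Y y0 \<psi> \<le> (1 - \<alpha>) * discounted_cost \<alpha> c y u"
proof -
  let ?d = "dual_objective \<alpha> f c U Y y0 \<psi>"
  have "(\<lambda>t. \<alpha> ^ t * ?d) sums (1 / (1 - \<alpha>) * ?d)"
    using \<alpha> by (intro sums_mult2 geometric_sums) auto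
  from sums_le[OF _ this lagrangian_sums[OF assms]]
  have "1 / (1 - \<alpha>) * ?d \<le> discounted_cost \<alpha> c y u"
    using \<alpha> by (simp add: mult_left_mono dual_objective_le[OF c \<psi>] process_in_G[OF p])
  then show ?thesis
    using \<alpha> by (simp add: field_simps)
qed

lemma optimal_value_le:
  assumes c: "continuous_on G c" and p: "admissible_process f U Y y0 y u"
  shows "optimal_value \<alpha> f c U Y y0 \<le> discounted_cost \<alpha> c y u"
  unfolding optimal_value_def
proof (rule cInf_lower)
  obtain B where B: "\<And>z. range z \<subseteq> G \<Longrightarrow> B \<le> (\<Sum>t. \<alpha> ^ t * c (z t))"
    using cost_lower_bound[OF c] by blast
  have "B \<le> discounted_cost \<alpha> c y u" if "admissible_process f U Y y0 y u" for y u
    using B[of "\<lambda>t. (y t, u t)"] process_in_G[OF that] by (auto simp: discounted_cost_def)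
  then show "bdd_below {discounted_cost \<alpha> c y u |y u. admissible_process f U Y y0 y u}"
    by (intro bdd_belowI[of _ B]) auto
qed (use p in auto)

section \<open>Occupational measures and the linear program\<close>

text \<open>The geometric distribution gives time \<open>t\<close> the weight
  \<open>(1 - \<alpha>) * \<alpha> ^ t\<close>, so integrals against its image under the process are
  normalized discounted sums.\<close>

definition occupational_measure :: "(nat \<Rightarrow> 'y) \<Rightarrow> (nat \<Rightarrow> 'u) \<Rightarrow> ('y \<times> 'u) measure" where
  "occupational_measure y u =
     distr (measure_pmf (geometric_pmf (1 - \<alpha>))) (restrict_space borel G) (\<lambda>t. (y t, u t))"

lemma integral_occupational_measure:
  fixes h :: "'y \<times> 'u \<Rightarrow> real"
  assumes h: "continuous_on G h" and p: "admissible_process f U Y y0 y u"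
  shows "(\<integral>z. h z \<partial>occupational_measure y u) = (1 - \<alpha>) * discounted_cost \<alpha> h y u"
proof -
  let ?M = "measure_pmf (geometric_pmf (1 - \<alpha>))"
  have pG: "(y t, u t) \<in> G" for t
    by (rule process_in_G[OF p])
  obtain B where B: "\<And>z. z \<in> G \<Longrightarrow> \<bar>h z\<bar> \<le> B"
    using bounded_on_G[OF h] by blast
  have "summable (\<lambda>t. \<alpha> ^ t * \<bar>h (y t, u t)\<bar>)"
    using B pG by (intro discounted_summable[OF \<alpha>, of _ B]) auto
  then have "summable (\<lambda>t. norm (pmf (geometric_pmf (1 - \<alpha>)) t * h (y t, u t)))"
    using \<alpha> summable_mult2[of "\<lambda>t. \<alpha> ^ t * \<bar>h (y t, u t)\<bar>" "1 - \<alpha>"]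
    by (simp add: abs_mult mult_ac)
  then have int: "integrable (count_space UNIV) (\<lambda>t. pmf (geometric_pmf (1 - \<alpha>)) t * h (y t, u t))"
    by (simp only: integrable_count_space_nat_iff)
  have "(\<integral>z. h z \<partial>occupational_measure y u) = (\<integral>t. h (y t, u t) \<partial>?M)"
    unfolding occupational_measure_def
    using pG by (intro integral_distr borel_measurable_continuous_on_restrict h)
      (auto simp: space_restrict_space)
  also have "\<dots> = (\<integral>t. pmf (geometric_pmf (1 - \<alpha>)) t * h (y t, u t) \<partial>count_space UNIV)"
    unfolding measure_pmf_eq_density by (subst integral_density) auto
  also have "\<dots> = (\<Sum>t. pmf (geometric_pmf (1 - \<alpha>)) t * h (y t, u t))"
    by (rule integral_count_space_nat[OF int])
  also have "\<dots> = (\<Sum>t. (1 - \<alpha>) * (\<alpha> ^ t * h (y t, u t)))"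
    using \<alpha> by (simp add: mult_ac)
  also have "\<dots> = (1 - \<alpha>) * discounted_cost \<alpha> h y u"
    unfolding discounted_cost_def
    using pG by (intro suminf_mult cost_summable[OF h, of "\<lambda>t. (y t, u t)"]) auto
  finally show ?thesis .
qed

lemma W_set_integrand_eq:
  "(\<lambda>(y, u). \<alpha> * (\<psi> (f (y, u)) - \<psi> y) + (1 - \<alpha>) * (\<psi> y0 - \<psi> y)) = lagrangian (\<lambda>_. 0) \<psi>"
  by (auto simp: lagrangian_def)

text \<open>By \<open>lagrangian_sums\<close> the Lagrangian of the zero cost has discounted sum
  zero along every process.\<close>

lemma occupational_measure_in_W:
  assumes p: "admissible_process f U Y y0 y u"
  shows "occupational_measure y u \<in> W_set \<alpha> f U Y y0"
proof -
  have "prob_space (occupational_measure y u)"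
    unfolding occupational_measure_def
    using process_in_G[OF p] by (intro measure_pmf.prob_space_distr) (auto simp: space_restrict_space)
  moreover have "(\<integral>z. lagrangian (\<lambda>_. 0) \<psi> z \<partial>occupational_measure y u) = 0"
    if "continuous_on Y \<psi>" for \<psi>
  proof -
    have "discounted_cost \<alpha> (lagrangian (\<lambda>_. 0) \<psi>) y u = discounted_cost \<alpha> (\<lambda>_. 0) y u"
      using sums_unique[OF lagrangian_sums[OF _ that p, of "\<lambda>_. 0"]]
      by (simp add: discounted_cost_def)
    then show ?thesis
      using integral_occupational_measure[OF continuous_lagrangian[OF _ that] p, of "\<lambda>_. 0"]
      by (simp add: discounted_cost_def)
  qed
  ultimately show ?thesis
    unfolding W_set_def borel_prob_measures_def W_set_integrand_eq
    by (simp add: occupational_measure_def)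
qed

text \<open>Integrating the Lagrangian against \<open>\<gamma>\<close> removes the terms in
  \<open>\<psi>\<close>, so the integral of \<open>c\<close> dominates every dual value. Strong
  duality turns this into a process whose normalized cost is no larger than the integral.\<close>

lemma integral_W_ge:
  assumes c: "continuous_on G c" and \<gamma>: "\<gamma> \<in> W_set \<alpha> f U Y y0"
  shows "(1 - \<alpha>) * optimal_value \<alpha> f c U Y y0 \<le> (\<integral>z. c z \<partial>\<gamma>)"
proof -
  have sets: "sets \<gamma> = sets (restrict_space borel G)" and "prob_space \<gamma>"
    and W: "\<And>\<psi>. continuous_on Y \<psi> \<Longrightarrow> (\<integral>z. lagrangian (\<lambda>_. 0) \<psi> z \<partial>\<gamma>) = 0"
    using \<gamma> unfolding W_set_def borel_prob_measures_def W_set_integrand_eq by auto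
  interpret prob_space \<gamma> by fact
  have space: "space \<gamma> = G"
    using sets_eq_imp_space_eq[OF sets] by (simp add: space_restrict_space)
  have int: "integrable \<gamma> h" if h: "continuous_on G h" for h :: "'y \<times> 'u \<Rightarrow> real"
  proof -
    obtain B where "\<And>z. z \<in> G \<Longrightarrow> \<bar>h z\<bar> \<le> B"
      using bounded_on_G[OF h] by blast
    then show ?thesis
      using borel_measurable_continuous_on_restrict[OF h]
      by (intro integrable_const_bound[of _ B]) (auto simp: space measurable_cong_sets[OF sets refl])
  qed
  have "dual_objective \<alpha> f c U Y y0 \<psi> \<le> (\<integral>z. c z \<partial>\<gamma>)" if \<psi>: "continuous_on Y \<psi>" for \<psi>
  proof -
    let ?d = "dual_objective \<alpha> f c U Y y0 \<psi>"
    have 0: "integrable \<gamma> (lagrangian (\<lambda>_. 0) \<psi>)"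
      by (intro int continuous_lagrangian \<psi>) auto
    have "?d = (\<integral>z. ?d \<partial>\<gamma>)"
      by (simp add: prob_space)
    also have "\<dots> \<le> (\<integral>z. lagrangian c \<psi> z \<partial>\<gamma>)"
      using dual_objective_le[OF c \<psi>]
      by (intro integral_mono int continuous_lagrangian c \<psi>) (auto simp: space)
    also have "\<dots> = (\<integral>z. c z + lagrangian (\<lambda>_. 0) \<psi> z \<partial>\<gamma>)"
      by (simp add: lagrangian_def add.assoc)
    also have "\<dots> = (\<integral>z. c z \<partial>\<gamma>)"
      using W[OF \<psi>] int[OF c] 0 by simp
    finally show ?thesis .
  qed
  then obtain y u where p: "admissible_process f U Y y0 y u"
    and le: "discounted_cost \<alpha> c y u \<le> (\<integral>z. c z \<partial>\<gamma>) / (1 - \<alpha>)"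
    using process_of_dual_bound[OF c, of "(\<integral>z. c z \<partial>\<gamma>) / (1 - \<alpha>)"] \<alpha> by auto
  have "optimal_value \<alpha> f c U Y y0 \<le> (\<integral>z. c z \<partial>\<gamma>) / (1 - \<alpha>)"
    using optimal_value_le[OF c p] le by (rule order_trans)
  then show ?thesis
    using \<alpha> by (simp add: pos_le_divide_eq mult.commute)
qed

text \<open>Uniqueness for the linear program will thus force all optimal processes to share one
  occupational measure.\<close>

lemma occupational_measure_arg_min:
  assumes c: "continuous_on G c" and p: "optimal_process \<alpha> f c U Y y0 y u"
  shows "is_arg_min (\<lambda>\<gamma>. \<integral>z. c z \<partial>\<gamma>) (\<lambda>\<gamma>. \<gamma> \<in> W_set \<alpha> f U Y y0) (occupational_measure y u)"
proof -
  have "(\<integral>z. c z \<partial>occupational_measure y u) = (1 - \<alpha>) * optimal_value \<alpha> f c U Y y0"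
    using integral_occupational_measure[OF c] p by (simp add: optimal_process_def)
  then show ?thesis
    using occupational_measure_in_W p integral_W_ge[OF c]
    by (auto simp: is_arg_min_def optimal_process_def not_less)
qed

end

section \<open>The spaces of approximating functions\<close>

text \<open>Padding with zero coefficients lets a fixed test function compete with the solutions for
  all larger \<open>N\<close>.\<close>

lemma D_space_mono:
  assumes "M \<le> N"
  shows "D_space Y \<phi> M \<subseteq> D_space Y \<phi> N"
proof
  fix \<psi>
  assume "\<psi> \<in> D_space Y \<phi> M"
  then obtain c where c: "\<forall>y\<in>Y. \<psi> y = (\<Sum>i=1..M. c i * \<phi> i y)"
    unfolding D_space_def by auto
  have "(\<Sum>i=1..M. c i * \<phi> i y) = (\<Sum>i=1..N. (if i \<le> M then c i else 0) * \<phi> i y)" for y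
    using assms by (intro sum.mono_neutral_cong_left) auto
  with c show "\<psi> \<in> D_space Y \<phi> N"
    unfolding D_space_def by (auto intro!: exI[of _ "\<lambda>i. if i \<le> M then c i else 0"])
qed

lemma D_space_combination:
  assumes "\<psi> \<in> D_space Y \<phi> N" "\<psi>' \<in> D_space Y \<phi> N"
  shows "(\<lambda>y. a * \<psi> y + b * \<psi>' y) \<in> D_space Y \<phi> N"
proof -
  obtain c c' where "\<forall>y\<in>Y. \<psi> y = (\<Sum>i=1..N. c i * \<phi> i y)" "\<forall>y\<in>Y. \<psi>' y = (\<Sum>i=1..N. c' i * \<phi> i y)"
    using assms unfolding D_space_def by auto
  then have "\<forall>y\<in>Y. a * \<psi> y + b * \<psi>' y = (\<Sum>i=1..N. (a * c i + b * c' i) * \<phi> i y)"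
    by (simp add: sum_distrib_left sum.distrib distrib_right mult.assoc)
  then show ?thesis
    unfolding D_space_def by (intro CollectI exI[of _ "\<lambda>i. a * c i + b * c' i"])
qed

lemma D_space_continuous:
  assumes "approx_basis Y \<phi>" "\<psi> \<in> D_space Y \<phi> N"
  shows "continuous_on Y \<psi>"
proof -
  obtain c where "\<forall>y\<in>Y. \<psi> y = (\<Sum>i=1..N. c i * \<phi> i y)"
    using assms(2) unfolding D_space_def by auto
  moreover have "continuous_on Y (\<lambda>y. \<Sum>i=1..N. c i * \<phi> i y)"
    using assms(1) unfolding approx_basis_def by (intro continuous_intros) auto
  ultimately show ?thesis
    by (simp cong: continuous_on_cong)
qed

section \<open>Approximating problems and perturbation of the cost\<close>

context compact_control_system
begin

text \<open>A real supremum bounds its members only if they are bounded above; weak duality with any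
  one process supplies the bound.\<close>

lemma approx_solution_maximal:
  assumes c: "continuous_on G c" and \<phi>: "approx_basis Y \<phi>"
    and p: "admissible_process f U Y y0 y u"
    and sol: "approx_solution \<alpha> f c U Y y0 \<phi> N \<psi>"
    and \<psi>': "\<psi>' \<in> D_space Y \<phi> N"
  shows "dual_objective \<alpha> f c U Y y0 \<psi>' \<le> dual_objective \<alpha> f c U Y y0 \<psi>"
proof -
  have "bdd_above (dual_objective \<alpha> f c U Y y0 ` D_space Y \<phi> N)"
    using dual_objective_le_cost[OF c _ p] D_space_continuous[OF \<phi>]
    by (intro bdd_aboveI2) auto
  then have "dual_objective \<alpha> f c U Y y0 \<psi>' \<le> approx_value \<alpha> f c U Y y0 \<phi> N"
    unfolding approx_value_def by (intro cSUP_upper \<psi>')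
  then show ?thesis
    using sol by (simp add: approx_solution_def)
qed

text \<open>
  Raising the cost away from the minimizers of the Lagrangian leaves the maximizer a local,
  hence by concavity a global, maximizer of the dual objective.
\<close>

lemma approx_solution_perturbed:
  assumes c: "continuous_on G c" and \<theta>: "continuous_on G \<theta>" and \<phi>: "approx_basis Y \<phi>"
    and p: "admissible_process f U Y y0 y u"
    and sol: "approx_solution \<alpha> f c U Y y0 \<phi> N \<psi>"
    and zero: "\<And>z. z \<in> G \<Longrightarrow> \<theta> z = 0 \<or> dual_objective \<alpha> f c U Y y0 \<psi> + \<eta> \<le> lagrangian c \<psi> z"
    and \<eta>: "0 < \<eta>"
    and \<psi>': "\<psi>' \<in> D_space Y \<phi> N"
  shows "dual_objective \<alpha> f (\<lambda>z. c z + \<theta> z) U Y y0 \<psi>' \<le> dual_objective \<alpha> f c U Y y0 \<psi>"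
    (is "?d' \<le> ?d")
proof (rule ccontr)
  assume "\<not> ?d' \<le> ?d"
  define \<epsilon> where "\<epsilon> = ?d' - ?d"
  have \<epsilon>: "0 < \<epsilon>"
    using \<open>\<not> ?d' \<le> ?d\<close> by (simp add: \<epsilon>_def)
  have \<psi>D: "\<psi> \<in> D_space Y \<phi> N"
    using sol by (simp add: approx_solution_def)
  note cont = D_space_continuous[OF \<phi> \<psi>D] D_space_continuous[OF \<phi> \<psi>']
  have c\<theta>: "continuous_on G (\<lambda>z. c z + \<theta> z)"
    by (intro continuous_intros c \<theta>)
  obtain B where B: "0 \<le> B" "\<And>z. z \<in> G \<Longrightarrow> \<bar>lagrangian c \<psi>' z - ?d\<bar> \<le> B"
    using bounded_on_G[OF continuous_on_diff[OF continuous_lagrangian[OF c cont(2)] continuous_on_const]]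
    by blast
  \<comment> \<open>Where \<open>\<theta>\<close> is nonzero, \<open>\<psi>\<close> has margin
    \<open>\<eta>\<close> and moving a fraction \<open>s\<close> towards \<open>\<psi>'\<close>
    costs at most \<open>s * (\<eta> + B)\<close>; this choice leaves half of the margin.\<close>
  define s where "s = \<eta> / (2 * (\<eta> + B))"
  have s: "0 < s" "s < 1" and s': "s * (\<eta> + B) = \<eta> / 2"
    using \<eta> B(1) by (auto simp: s_def field_simps)
  let ?\<psi> = "\<lambda>y. (1 - s) * \<psi> y + s * \<psi>' y"
  have "?d + min (\<eta> / 2) (s * \<epsilon>) \<le> dual_objective \<alpha> f c U Y y0 ?\<psi>"
  proof (rule dual_objective_ge)
    fix z
    assume z: "z \<in> G"
    have eq: "lagrangian c ?\<psi> z = (1 - s) * lagrangian c \<psi> z + s * lagrangian c \<psi>' z"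
      by (simp add: lagrangian_def algebra_simps)
    show "?d + min (\<eta> / 2) (s * \<epsilon>) \<le> lagrangian c ?\<psi> z"
    proof (cases "\<theta> z = 0")
      \<comment> \<open>Where \<open>\<theta>\<close> vanishes both costs have the same Lagrangian,
        so the mixture inherits the fraction \<open>s\<close> of the supposed gain
        \<open>\<epsilon>\<close>.\<close>
      case True
      then have "?d' \<le> lagrangian c \<psi>' z"
        using dual_objective_le[OF c\<theta> cont(2) z] by (simp add: lagrangian_def)
      then have "(1 - s) * ?d + s * ?d' \<le> lagrangian c ?\<psi> z"
        unfolding eq using s dual_objective_le[OF c cont(1) z]
        by (intro add_mono mult_left_mono) auto
      then show ?thesis
        by (simp add: \<epsilon>_def algebra_simps min_def)
    next
      case False
      then have "?d + \<eta> \<le> lagrangian c \<psi> z"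
        using zero[OF z] by simp
      moreover have "?d - B \<le> lagrangian c \<psi>' z"
        using B(2)[OF z] by linarith
      ultimately have "(1 - s) * (?d + \<eta>) + s * (?d - B) \<le> lagrangian c ?\<psi> z"
        unfolding eq using s by (intro add_mono mult_left_mono) auto
      moreover have "(1 - s) * (?d + \<eta>) + s * (?d - B) = ?d + \<eta> / 2"
        using s' by (simp add: algebra_simps)
      ultimately show ?thesis
        by (simp add: min_def)
    qed
  qed
  moreover have "dual_objective \<alpha> f c U Y y0 ?\<psi> \<le> ?d"
    by (rule approx_solution_maximal[OF c \<phi> p sol D_space_combination[OF \<psi>D \<psi>']])
  moreover have "0 < min (\<eta> / 2) (s * \<epsilon>)"
    using \<eta> s \<epsilon> by simp
  ultimately show False
    by linarith
qed

lemma dual_objective_approx: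
  assumes c: "continuous_on G c" and \<phi>: "approx_basis Y \<phi>" and \<psi>: "continuous_on Y \<psi>"
    and \<epsilon>: "0 < \<epsilon>"
  obtains N \<psi>' where "\<psi>' \<in> D_space Y \<phi> N"
    "dual_objective \<alpha> f c U Y y0 \<psi> - \<epsilon> \<le> dual_objective \<alpha> f c U Y y0 \<psi>'"
proof -
  \<comment> \<open>After regrouping, \<open>\<psi>\<close> enters the Lagrangian in three terms
    with coefficients of modulus at most 1, so the total change is at most
    \<open>3 * \<epsilon> / 4\<close>.\<close>
  obtain N a where a: "\<forall>y\<in>Y. \<bar>\<psi> y - (\<Sum>i=1..N. a i * \<phi> i y)\<bar> \<le> \<epsilon> / 4"
  proof -
    from \<phi> have "\<forall>\<psi> \<delta>. continuous_on Y \<psi> \<and> \<delta> > 0 \<longrightarrow>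
        (\<exists>N a. \<forall>y\<in>Y. \<bar>\<psi> y - (\<Sum>i=1..N. a i * \<phi> i y)\<bar> \<le> \<delta>)"
      unfolding approx_basis_def by (elim conjE)
    from this[rule_format, of \<psi> "\<epsilon> / 4"] \<psi> \<epsilon> show ?thesis
      using that by auto
  qed
  define \<psi>' where "\<psi>' y = (\<Sum>i=1..N. a i * \<phi> i y)" for y
  have close: "\<bar>\<psi> y - \<psi>' y\<bar> \<le> \<epsilon> / 4" if "y \<in> Y" for y
    using a that by (simp add: \<psi>'_def)
  have "dual_objective \<alpha> f c U Y y0 \<psi> - \<epsilon> \<le> dual_objective \<alpha> f c U Y y0 \<psi>'"
  proof (rule dual_objective_ge)
    fix z
    assume z: "z \<in> G"
    have "\<bar>\<alpha> * (\<psi> (f z) - \<psi>' (f z))\<bar> \<le> 1 * (\<epsilon> / 4)"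
      unfolding abs_mult using \<alpha> close[OF f_in_Y[OF z]] by (intro mult_mono) auto
    moreover have "\<bar>(1 - \<alpha>) * (\<psi> y0 - \<psi>' y0)\<bar> \<le> 1 * (\<epsilon> / 4)"
      unfolding abs_mult using \<alpha> close[OF y0] by (intro mult_mono) auto
    moreover have "\<bar>\<psi> (fst z) - \<psi>' (fst z)\<bar> \<le> \<epsilon> / 4"
      by (rule close[OF fst_in_Y[OF z]])
    moreover have "lagrangian c \<psi> z - lagrangian c \<psi>' z =
        \<alpha> * (\<psi> (f z) - \<psi>' (f z)) + (1 - \<alpha>) * (\<psi> y0 - \<psi>' y0) - (\<psi> (fst z) - \<psi>' (fst z))"
      by (simp add: lagrangian_def algebra_simps)
    ultimately have "lagrangian c \<psi> z - lagrangian c \<psi>' z \<le> \<epsilon>"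
      using \<epsilon> by linarith
    with dual_objective_le[OF c \<psi> z]
    show "dual_objective \<alpha> f c U Y y0 \<psi> - \<epsilon> \<le> lagrangian c \<psi>' z"
      by linarith
  qed
  moreover have "\<psi>' \<in> D_space Y \<phi> N"
    unfolding D_space_def \<psi>'_def by auto
  ultimately show ?thesis
    by (rule that[rotated])
qed

text \<open>Here uniqueness for the linear program enters. The minimizers are only shown to come
  near the optimal pair, at states that may differ from \<open>y t\<close>.\<close>

lemma minimizers_approach_optimal_process:
  assumes c: "continuous_on G c" and \<phi>: "approx_basis Y \<phi>"
    and sol: "\<And>N. N \<ge> 1 \<Longrightarrow> approx_solution \<alpha> f c U Y y0 \<phi> N (\<psi> N)"
    and unique: "\<exists>!\<gamma>. is_arg_min (\<lambda>\<gamma>. \<integral>z. c z \<partial>\<gamma>) (\<lambda>\<gamma>. \<gamma> \<in> W_set \<alpha> f U Y y0) \<gamma>"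
    and opt: "optimal_process \<alpha> f c U Y y0 y u"
    and \<rho>: "0 < \<rho>"
  shows "\<forall>\<^sub>F N in sequentially. \<exists>z\<in>G. dist (y t, u t) z \<le> \<rho> \<and>
    lagrangian c (\<psi> N) z \<le> dual_objective \<alpha> f c U Y y0 (\<psi> N)"
proof (rule ccontr)
  assume "\<not> ?thesis"
  then have freq: "\<exists>N\<ge>M. \<forall>z\<in>G. dist (y t, u t) z \<le> \<rho> \<longrightarrow>
      dual_objective \<alpha> f c U Y y0 (\<psi> N) < lagrangian c (\<psi> N) z" for M
    unfolding eventually_sequentially not_le[symmetric] by blast
  have p: "admissible_process f U Y y0 y u"
    and cost: "discounted_cost \<alpha> c y u = optimal_value \<alpha> f c U Y y0"
    using opt by (auto simp: optimal_process_def)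
  \<comment> \<open>A tent that vanishes off the open ball of radius \<open>\<rho>\<close>, so a
    margin is needed only on the closed ball, and that has equal value \<open>\<rho>\<close> at its
    centre \<open>(y t, u t)\<close>.\<close>
  define \<theta> where "\<theta> z = max 0 (\<rho> - dist (y t, u t) z)" for z
  have \<theta>: "continuous_on G \<theta>"
    unfolding \<theta>_def by (intro continuous_intros)
  have c\<theta>: "continuous_on G (\<lambda>z. c z + \<theta> z)"
    by (intro continuous_intros c \<theta>)
  have "dual_objective \<alpha> f (\<lambda>z. c z + \<theta> z) U Y y0 \<psi>' \<le> (1 - \<alpha>) * optimal_value \<alpha> f c U Y y0"
    if \<psi>': "continuous_on Y \<psi>'" for \<psi>'
  proof (rule field_le_epsilon)
    fix \<epsilon> :: real
    assume "0 < \<epsilon>"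
    then obtain M \<psi>'' where \<psi>'': "\<psi>'' \<in> D_space Y \<phi> M"
      and close: "dual_objective \<alpha> f (\<lambda>z. c z + \<theta> z) U Y y0 \<psi>' - \<epsilon>
        \<le> dual_objective \<alpha> f (\<lambda>z. c z + \<theta> z) U Y y0 \<psi>''"
      using dual_objective_approx[OF c\<theta> \<phi> \<psi>'] by blast
    obtain N where N: "max 1 M \<le> N" and away: "\<And>z. z \<in> G \<Longrightarrow> dist (y t, u t) z \<le> \<rho> \<Longrightarrow>
        dual_objective \<alpha> f c U Y y0 (\<psi> N) < lagrangian c (\<psi> N) z"
      using freq by blast
    let ?d = "dual_objective \<alpha> f c U Y y0 (\<psi> N)"
    have solN: "approx_solution \<alpha> f c U Y y0 \<phi> N (\<psi> N)"
      using N by (intro sol) auto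
    then have cont: "continuous_on Y (\<psi> N)"
      by (intro D_space_continuous[OF \<phi>, of _ N]) (simp add: approx_solution_def)
    \<comment> \<open>Compactness upgrades the strict inequality \<open>away\<close> to a positive
      margin: the minimum of the Lagrangian over \<open>?K\<close>, less \<open>?d\<close>.\<close>
    let ?K = "G \<inter> cball (y t, u t) \<rho>"
    have "compact ?K"
      by (intro compact_Int_closed compact_G closed_cball)
    moreover have "?K \<noteq> {}"
      using process_in_G[OF p, of t] \<rho> by auto
    moreover have "continuous_on ?K (lagrangian c (\<psi> N))"
      by (rule continuous_on_subset[OF continuous_lagrangian[OF c cont]]) auto
    ultimately obtain z0 where z0: "z0 \<in> ?K"
      and min: "\<And>z. z \<in> ?K \<Longrightarrow> lagrangian c (\<psi> N) z0 \<le> lagrangian c (\<psi> N) z"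
      using continuous_attains_inf by metis
    have "dual_objective \<alpha> f (\<lambda>z. c z + \<theta> z) U Y y0 \<psi>'' \<le> ?d"
    proof (rule approx_solution_perturbed[OF c \<theta> \<phi> p solN])
      show "0 < lagrangian c (\<psi> N) z0 - ?d"
        using away z0 by auto
      show "\<theta> z = 0 \<or> ?d + (lagrangian c (\<psi> N) z0 - ?d) \<le> lagrangian c (\<psi> N) z" if "z \<in> G" for z
        using min[of z] that by (cases "dist (y t, u t) z \<le> \<rho>") (auto simp: \<theta>_def max_def)
      show "\<psi>'' \<in> D_space Y \<phi> N"
        using D_space_mono[of M N] N \<psi>'' by auto
    qed
    moreover have "?d \<le> (1 - \<alpha>) * optimal_value \<alpha> f c U Y y0"
      using dual_objective_le_cost[OF c cont p] cost by simp
    ultimately show "dual_objective \<alpha> f (\<lambda>z. c z + \<theta> z) U Y y0 \<psi>'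
        \<le> (1 - \<alpha>) * optimal_value \<alpha> f c U Y y0 + \<epsilon>"
      using close by linarith
  qed
  then obtain y' u' where p': "admissible_process f U Y y0 y' u'"
    and cost': "discounted_cost \<alpha> (\<lambda>z. c z + \<theta> z) y' u' \<le> optimal_value \<alpha> f c U Y y0"
    using process_of_dual_bound[OF c\<theta>] by blast
  have summable: "summable (\<lambda>t. \<alpha> ^ t * h (q t, v t))"
    if "admissible_process f U Y y0 q v" "continuous_on G h" for h q v
    using cost_summable[OF that(2), of "\<lambda>t. (q t, v t)"] process_in_G[OF that(1)]
    by (simp add: image_subset_iff)
  \<comment> \<open>The first summand is at least the optimal value, the second at least 0, and the
    sum at most the optimal value, so both bounds are attained.\<close>
  have "discounted_cost \<alpha> (\<lambda>z. c z + \<theta> z) y' u' = discounted_cost \<alpha> c y' u' + discounted_cost \<alpha> \<theta> y' u'"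
    unfolding discounted_cost_def distrib_left
    by (intro suminf_add[symmetric] summable p' c \<theta>)
  moreover have "0 \<le> discounted_cost \<alpha> \<theta> y' u'"
    unfolding discounted_cost_def
    using \<alpha> by (intro suminf_nonneg summable p' \<theta>) (auto simp: \<theta>_def)
  moreover note optimal_value_le[OF c p'] cost'
  ultimately have "discounted_cost \<alpha> c y' u' = optimal_value \<alpha> f c U Y y0"
    and avoid: "discounted_cost \<alpha> \<theta> y' u' = 0"
    by linarith+
  then have "optimal_process \<alpha> f c U Y y0 y' u'"
    using p' by (simp add: optimal_process_def)
  then have "occupational_measure y' u' = occupational_measure y u"
    using unique occupational_measure_arg_min[OF c] opt by blast
  \<comment> \<open>Equal occupational measures give equal discounted sums of
    \<open>\<theta>\<close>, although \<open>\<theta>\<close> equals \<open>\<rho>\<close> at time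
    \<open>t\<close> of the given process.\<close>
  then have "discounted_cost \<alpha> \<theta> y u = 0"
    using integral_occupational_measure[OF \<theta> p] integral_occupational_measure[OF \<theta> p'] avoid \<alpha>
    by simp
  moreover have "\<alpha> ^ t * \<theta> (y t, u t) \<le> discounted_cost \<alpha> \<theta> y u"
    unfolding discounted_cost_def
    using sum_le_suminf[OF summable[OF p \<theta>], of "{t}"] \<alpha> by (auto simp: \<theta>_def)
  moreover have "0 < \<alpha> ^ t * \<theta> (y t, u t)"
    using \<alpha> \<rho> by (simp add: \<theta>_def)
  ultimately show False
    by linarith
qed

text \<open>For fixed \<open>y\<close> the Lagrangian differs from
  \<open>c (y, u) + \<alpha> * \<psi> (f (y, u))\<close> by a quantity independent of
  \<open>u\<close>.\<close>

lemma minimizing_control_of_lagrangian: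
  assumes c: "continuous_on G c" and \<psi>: "continuous_on Y \<psi>" and z: "(y, u) \<in> G"
    and min: "lagrangian c \<psi> (y, u) \<le> dual_objective \<alpha> f c U Y y0 \<psi>"
  shows "minimizing_control \<alpha> f c U Y \<psi> y u"
  unfolding minimizing_control_def is_arg_min_def
proof (intro conjI notI)
  show "u \<in> admissible_controls f U Y y"
    using z by (simp add: admissible_graph_def)
  assume "\<exists>v. v \<in> admissible_controls f U Y y \<and>
    c (y, v) + \<alpha> * \<psi> (f (y, v)) < c (y, u) + \<alpha> * \<psi> (f (y, u))"
  then obtain v where v: "v \<in> admissible_controls f U Y y"
    and less: "c (y, v) + \<alpha> * \<psi> (f (y, v)) < c (y, u) + \<alpha> * \<psi> (f (y, u))"
    by auto
  have "(y, v) \<in> G"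
    using v z by (simp add: admissible_graph_def)
  from dual_objective_le[OF c \<psi> this] min less show False
    by (simp add: lagrangian_def algebra_simps)
qed

end

section \<open>Compactness of the admissible graph\<close>

text \<open>Upper semicontinuity with compact values closes the graph of \<open>U\<close>, and the
  constraint that \<open>f\<close> maps into the closed set \<open>Y\<close> passes to limits; what
  remains is a closed part of a compact product.\<close>

lemma compact_admissible_graph:
  fixes Y :: "'y::metric_space set" and U0 :: "'u::metric_space set"
  assumes "compact Y" "compact U0"
    and U: "\<And>y. y \<in> Y \<Longrightarrow> U y \<subseteq> U0" "\<And>y. y \<in> Y \<Longrightarrow> compact (U y)"
    and usc: "upper_semicontinuous_on Y U"
    and f: "continuous_on (Y \<times> U0) f"
  shows "compact (admissible_graph f U Y)"
proof -
  have sub: "admissible_graph f U Y \<subseteq> Y \<times> U0"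
    using U(1) by (auto simp: admissible_graph_def admissible_controls_def)
  have "closed (admissible_graph f U Y)"
    unfolding closed_sequential_limits
  proof (intro allI impI, elim conjE)
    fix z l
    assume z: "\<forall>n. z n \<in> admissible_graph f U Y" and lim: "z \<longlonglongrightarrow> l"
    have zYU: "z n \<in> Y \<times> U0" for n
      using z sub by blast
    have "closed (Y \<times> U0)"
      using assms(1,2) by (intro compact_imp_closed compact_Times)
    then have l: "l \<in> Y \<times> U0"
      by (rule closed_sequentially[OF _ zYU lim])
    have limf: "(\<lambda>n. f (z n)) \<longlonglongrightarrow> f l"
      using zYU by (intro continuous_on_tendsto_compose[OF f lim l]) auto
    have "f (z n) \<in> Y" for n
      using z[rule_format, of n] by (auto simp: admissible_graph_def admissible_controls_def)
    then have "f l \<in> Y"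
      by (rule closed_sequentially[OF compact_imp_closed[OF assms(1)] _ limf])
    moreover have "snd l \<in> U (fst l)"
    proof (rule ccontr)
      assume notin: "snd l \<notin> U (fst l)"
      have lY: "fst l \<in> Y"
        using l by auto
      obtain V W where V: "open V" "snd l \<in> V" and W: "open W" "U (fst l) \<subseteq> W" and "V \<inter> W = {}"
      proof -
        have "open (- U (fst l))"
          by (intro open_Compl compact_imp_closed U(2) lY)
        then obtain e where e: "0 < e" "cball (snd l) e \<subseteq> - U (fst l)"
          using notin open_contains_cball by (metis ComplI)
        show ?thesis
          by (rule that[of "ball (snd l) e" "- cball (snd l) e"]) (use e in auto)
      qed
      have "\<forall>\<^sub>F y in at (fst l) within Y. U y \<subseteq> W"
        using usc lY W unfolding upper_semicontinuous_on_def by blast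
      then obtain S where S: "open S" "fst l \<in> S" "\<And>y. y \<in> S \<Longrightarrow> y \<noteq> fst l \<Longrightarrow> y \<in> Y \<Longrightarrow> U y \<subseteq> W"
        unfolding eventually_at_topological by blast
      have "\<forall>\<^sub>F n in sequentially. fst (z n) \<in> S"
        using topological_tendstoD[OF tendsto_fst[OF lim] S(1,2)] .
      moreover have "\<forall>\<^sub>F n in sequentially. snd (z n) \<in> V"
        using topological_tendstoD[OF tendsto_snd[OF lim] V] .
      ultimately have "\<forall>\<^sub>F n in sequentially. fst (z n) \<in> S \<and> snd (z n) \<in> V"
        by (rule eventually_conj)
      then obtain n where n: "fst (z n) \<in> S" "snd (z n) \<in> V"
        using eventually_happens by fastforce
      have "fst (z n) \<in> Y" "snd (z n) \<in> U (fst (z n))"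
        using z[rule_format, of n] by (auto simp: admissible_graph_def admissible_controls_def)
      then have "snd (z n) \<in> W"
        \<comment> \<open>The filter \<open>at (fst l) within Y\<close> omits the point itself,
          where the inclusion is part of the choice of \<open>W\<close>.\<close>
        using S(3)[OF n(1)] W(2) by (cases "fst (z n) = fst l") auto
      with n(2) \<open>V \<inter> W = {}\<close> show False
        by auto
    qed
    ultimately show "l \<in> admissible_graph f U Y"
      using l by (cases l) (auto simp: admissible_graph_def admissible_controls_def)
  qed
  then have "compact ((Y \<times> U0) \<inter> admissible_graph f U Y)"
    using assms(1,2) by (intro compact_Int_closed compact_Times)
  with sub show ?thesis
    by (simp add: inf.absorb2)
qed

section \<open>Convergence of the feedback controls, trajectories and values\<close>

theorem theorem4p1:
  fixes Y :: "(real ^ 'm) set"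
    and U0 :: "'u::metric_space set"
    and U :: "real ^ 'm \<Rightarrow> 'u set"
    and f :: "(real ^ 'm) \<times> 'u \<Rightarrow> real ^ 'm"
    and g :: "(real ^ 'm) \<times> 'u \<Rightarrow> real"
    and \<alpha> :: real
    and y0 :: "real ^ 'm"
    and \<phi> :: "nat \<Rightarrow> real ^ 'm \<Rightarrow> real"
    and \<psi> :: "nat \<Rightarrow> real ^ 'm \<Rightarrow> real"
    and uN :: "nat \<Rightarrow> real ^ 'm \<Rightarrow> 'u"
    and yN :: "nat \<Rightarrow> nat \<Rightarrow> real ^ 'm"
    and ybar :: "nat \<Rightarrow> real ^ 'm"
    and ubar :: "nat \<Rightarrow> 'u"
    and r :: "nat \<Rightarrow> real"
  assumes Y: "compact Y" "Y \<noteq> {}"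
    and U0: "compact U0"
    and U: "\<And>y. y \<in> Y \<Longrightarrow> U y \<subseteq> U0" "\<And>y. y \<in> Y \<Longrightarrow> compact (U y)"
      "upper_semicontinuous_on Y U"
    and f: "continuous_on (UNIV \<times> U0) f" "\<exists>L. L-lipschitz_on (UNIV \<times> U0) f"
    and g: "continuous_on (UNIV \<times> U0) g" "\<exists>L. L-lipschitz_on (UNIV \<times> U0) g"
    and \<alpha>: "0 < \<alpha>" "\<alpha> < 1"
    and A: "\<And>y. y \<in> Y \<Longrightarrow> admissible_controls f U Y y \<noteq> {}"
    and \<phi>: "approx_basis Y \<phi>"
    and y0: "y0 \<in> Y"
    and reachable: "interior (closure (reachable_set f U Y y0)) \<noteq> {}"
    and unique: "\<exists>!\<gamma>. is_arg_min (\<lambda>\<gamma>. \<integral>z. g z \<partial>\<gamma>) (\<lambda>\<gamma>. \<gamma> \<in> W_set \<alpha> f U Y y0) \<gamma>"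
    and \<psi>: "\<And>N. N \<ge> 1 \<Longrightarrow> approx_solution \<alpha> f g U Y y0 \<phi> N (\<psi> N)"
    and uN: "\<And>N y. N \<ge> 1 \<Longrightarrow> y \<in> Y \<Longrightarrow> minimizing_control \<alpha> f g U Y (\<psi> N) y (uN N y)"
    and yN: "\<And>N. N \<ge> 1 \<Longrightarrow> yN N 0 = y0"
      "\<And>N t. N \<ge> 1 \<Longrightarrow> yN N (Suc t) = f (yN N t, uN N (yN N t))"
    and optimal: "optimal_process \<alpha> f g U Y y0 ybar ubar"
    and r: "\<And>t. r t > 0"
    and a: "\<And>N t y. N \<ge> 1 \<Longrightarrow> y \<in> ball (ybar t) (r t) \<inter> Y \<Longrightarrow>
      \<exists>!u. minimizing_control \<alpha> f g U Y (\<psi> N) y u"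
    and b: "\<exists>L. \<forall>N\<ge>1. \<forall>t. L-lipschitz_on (ball (ybar t) (r t) \<inter> Y) (uN N)"
    and c: "\<forall>\<^sub>F N in sequentially. \<forall>t. yN N t \<in> ball (ybar t) (r t)"
  shows "(\<forall>t. (\<lambda>N. uN N (yN N t)) \<longlonglongrightarrow> ubar t \<and> (\<lambda>N. yN N t) \<longlonglongrightarrow> ybar t) \<and>
    (\<lambda>N. discounted_cost \<alpha> g (yN N) (\<lambda>t. uN N (yN N t))) \<longlonglongrightarrow> optimal_value \<alpha> f g U Y y0"
proof -
  let ?G = "admissible_graph f U Y"
  have G_sub: "?G \<subseteq> UNIV \<times> U0"
    using U(1) by (auto simp: admissible_graph_def admissible_controls_def)
  have compact_G: "compact ?G"
    using Y(1) U0 U continuous_on_subset[OF f(1)] by (rule compact_admissible_graph) auto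
  have cont_g: "continuous_on ?G g" and cont_f: "continuous_on ?G f"
    using continuous_on_subset[OF g(1) G_sub] continuous_on_subset[OF f(1) G_sub] by auto
  interpret compact_control_system \<alpha> f U Y y0
    by unfold_locales (use \<alpha> Y(1) compact_G cont_f A y0 in auto)
  have p: "admissible_process f U Y y0 ybar ubar"
    using optimal by (simp add: optimal_process_def)
  have pG: "(ybar t, ubar t) \<in> ?G" for t
    by (rule process_in_G[OF p])
  then have ybarY: "ybar t \<in> Y" for t
    using fst_in_Y by fastforce
  have pN: "admissible_process f U Y y0 (yN N) (\<lambda>t. uN N (yN N t))" if N: "N \<ge> 1" for N
  proof -
    have ctrl: "uN N y \<in> admissible_controls f U Y y" if "y \<in> Y" for y
      using uN[OF N that] by (simp add: minimizing_control_def is_arg_min_def)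
    have "yN N t \<in> Y" for t
      using ctrl yN[OF N] y0 by (induction t) (auto simp: admissible_controls_def)
    then show ?thesis
      using ctrl yN[OF N] by (simp add: admissible_process_def)
  qed
  have pNG: "(yN N t, uN N (yN N t)) \<in> ?G" if "N \<ge> 1" for N t
    by (rule process_in_G[OF pN[OF that]])
  obtain L where L: "\<And>N t. N \<ge> 1 \<Longrightarrow> L-lipschitz_on (ball (ybar t) (r t) \<inter> Y) (uN N)"
    using b by blast
  have L0: "0 \<le> L"
    using lipschitz_on_nonneg[OF L[of 1]] by simp

  \<comment> \<open>The feedback is first evaluated at the fixed state \<open>ybar t\<close>: a
    nearby minimizer \<open>(y, u)\<close> of the Lagrangian has \<open>u = uN N y\<close> by
    uniqueness (a), and the Lipschitz bound (b) moves the state from \<open>y\<close> to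
    \<open>ybar t\<close>.\<close>
  have ubar_lim: "(\<lambda>N. uN N (ybar t)) \<longlonglongrightarrow> ubar t" for t
  proof (rule metric_LIMSEQ_I)
    fix e :: real
    assume e: "0 < e"
    \<comment> \<open>The first bound keeps \<open>y\<close> in the ball where (a) and (b) apply;
      the second makes \<open>L * \<rho> + \<rho>\<close> at most \<open>e / 2\<close>, with
      \<open>L + 1\<close> positive even if \<open>L = 0\<close>.\<close>
    define \<rho> where "\<rho> = min (r t / 2) (e / (2 * (L + 1)))"
    have \<rho>: "0 < \<rho>" "\<rho> < r t"
      using r[of t] e L0 by (auto simp: \<rho>_def)
    have "(L + 1) * \<rho> \<le> (L + 1) * (e / (2 * (L + 1)))"
      using L0 by (intro mult_left_mono) (auto simp: \<rho>_def)
    also have "\<dots> < e"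
      using L0 e by (simp add: field_simps add_pos_nonneg)
    finally have \<rho>e: "L * \<rho> + \<rho> < e"
      by (simp add: algebra_simps)
    have "\<forall>\<^sub>F N in sequentially. \<exists>z\<in>?G. dist (ybar t, ubar t) z \<le> \<rho> \<and>
        lagrangian g (\<psi> N) z \<le> dual_objective \<alpha> f g U Y y0 (\<psi> N)"
      by (rule minimizers_approach_optimal_process[OF cont_g \<phi> \<psi> unique optimal \<rho>(1)])
    then have "\<forall>\<^sub>F N in sequentially. dist (uN N (ybar t)) (ubar t) < e"
      using eventually_ge_at_top[of 1]
    proof eventually_elim
      case (elim N)
      then obtain y u where z: "(y, u) \<in> ?G" and near: "dist (ybar t, ubar t) (y, u) \<le> \<rho>"
        and min: "lagrangian g (\<psi> N) (y, u) \<le> dual_objective \<alpha> f g U Y y0 (\<psi> N)"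
        by auto
      have cont: "continuous_on Y (\<psi> N)"
        using \<psi>[OF elim(2)] by (intro D_space_continuous[OF \<phi>, of _ N]) (simp add: approx_solution_def)
      have dy: "dist (ybar t) y \<le> \<rho>" and du: "dist (ubar t) u \<le> \<rho>"
        using dist_fst_le[of "(ybar t, ubar t)" "(y, u)"] dist_snd_le[of "(ybar t, ubar t)" "(y, u)"] near
        by auto
      have yY: "y \<in> Y"
        using fst_in_Y[OF z] by simp
      have yB: "y \<in> ball (ybar t) (r t) \<inter> Y"
        using dy \<rho> yY by auto
      have "u = uN N y"
        using a[OF elim(2) yB] uN[OF elim(2) yY] minimizing_control_of_lagrangian[OF cont_g cont z min]
        by blast
      moreover have "dist (uN N (ybar t)) (uN N y) \<le> L * dist (ybar t) y"
        using yB ybarY r by (intro lipschitz_onD[OF L[OF elim(2)]]) auto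
      moreover have "L * dist (ybar t) y \<le> L * \<rho>"
        by (rule mult_left_mono[OF dy L0])
      ultimately show ?case
        using \<rho>e du dist_triangle[of "uN N (ybar t)" "ubar t" u] by (simp add: dist_commute)
    qed
    then show "\<exists>M. \<forall>N\<ge>M. dist (uN N (ybar t)) (ubar t) < e"
      by (simp add: eventually_sequentially)
  qed

  \<comment> \<open>Stated conditionally so that it can serve inside the induction on
    \<open>t\<close>. By (c) the trajectory stays in the ball, so (b) compares the controls at
    \<open>yN N t\<close> and \<open>ybar t\<close>.\<close>
  have u_lim: "(\<lambda>N. uN N (yN N t)) \<longlonglongrightarrow> ubar t" if y_lim: "(\<lambda>N. yN N t) \<longlonglongrightarrow> ybar t" for t
  proof -
    have "\<forall>\<^sub>F N in sequentially. dist (uN N (yN N t)) (uN N (ybar t)) \<le> L * dist (yN N t) (ybar t)"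
      using c eventually_ge_at_top[of 1]
    proof eventually_elim
      case (elim N)
      then show ?case
        using fst_in_Y[OF pNG[OF elim(2)]] ybarY r by (intro lipschitz_onD[OF L[OF elim(2)]]) auto
    qed
    then have "\<forall>\<^sub>F N in sequentially. norm (dist (uN N (yN N t)) (ubar t))
        \<le> L * dist (yN N t) (ybar t) + dist (uN N (ybar t)) (ubar t)"
      unfolding real_norm_def abs_of_nonneg[OF zero_le_dist]
      by (rule eventually_mono) (rule order_trans[OF dist_triangle add_right_mono])
    moreover have "(\<lambda>N. L * dist (yN N t) (ybar t) + dist (uN N (ybar t)) (ubar t)) \<longlonglongrightarrow> 0"
      using y_lim ubar_lim[of t] unfolding tendsto_dist_iff[of _ "ybar t"] tendsto_dist_iff[of _ "ubar t"]
      by (intro tendsto_add_zero tendsto_mult_right_zero)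
    ultimately have "(\<lambda>N. dist (uN N (yN N t)) (ubar t)) \<longlonglongrightarrow> 0"
      by (rule Lim_null_comparison)
    then show ?thesis
      unfolding tendsto_dist_iff[of _ "ubar t"] .
  qed

  have pN_ev: "\<forall>\<^sub>F N in sequentially. \<forall>t. (yN N t, uN N (yN N t)) \<in> ?G"
    using pNG by (auto intro: eventually_sequentiallyI[of 1])
  have pair_lim: "(\<lambda>N. h (yN N t, uN N (yN N t))) \<longlonglongrightarrow> h (ybar t, ubar t)"
    if "continuous_on ?G h" "(\<lambda>N. yN N t) \<longlonglongrightarrow> ybar t" for h :: "_ \<Rightarrow> 'b::topological_space" and t
    using that pG pN_ev
    by (intro continuous_on_tendsto_compose[OF that(1)] tendsto_Pair u_lim) (auto elim: eventually_mono)
  \<comment> \<open>Convergence of the state at \<open>t\<close> gives that of the control, and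
    continuity of \<open>f\<close> on the graph carries both to time \<open>t + 1\<close>.\<close>
  have y_lim: "(\<lambda>N. yN N t) \<longlonglongrightarrow> ybar t" for t
  proof (induction t)
    case 0
    have "\<forall>\<^sub>F N in sequentially. yN N 0 = ybar 0"
      using yN(1) p by (auto intro: eventually_sequentiallyI[of 1] simp: admissible_process_def)
    then show ?case
      by (rule tendsto_eventually)
  next
    case (Suc t)
    have "\<forall>\<^sub>F N in sequentially. f (yN N t, uN N (yN N t)) = yN N (Suc t)"
      using yN(2) by (auto intro: eventually_sequentiallyI[of 1])
    moreover have "f (ybar t, ubar t) = ybar (Suc t)"
      using p by (simp add: admissible_process_def)
    ultimately show ?case
      using pair_lim[OF cont_f Suc] by (simp add: tendsto_cong)
  qed
  obtain B where B: "\<And>z. z \<in> ?G \<Longrightarrow> \<bar>g z\<bar> \<le> B"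
    using bounded_on_G[OF cont_g] by blast
  have "(\<lambda>N. discounted_cost \<alpha> g (yN N) (\<lambda>t. uN N (yN N t))) \<longlonglongrightarrow> discounted_cost \<alpha> g ybar ubar"
    unfolding discounted_cost_def
  proof (rule discounted_tendsto[OF \<alpha>])
    show "\<forall>\<^sub>F N in sequentially. \<forall>t. \<bar>g (yN N t, uN N (yN N t))\<bar> \<le> B"
      using pN_ev by eventually_elim (auto intro: B)
  qed (rule pair_lim[OF cont_g y_lim])
  then show ?thesis
    using y_lim u_lim optimal by (simp add: optimal_process_def)
qed

end
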